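(* Let $M$ be a screen generic lightlike submanifold of a locally bronze semi-Riemannian manifold $(\bar M,\bar g,\bar J)$ equipped with an $(l,m)$-type connection $\bar\Omega$. Then $M$ is mixed geodesic if and only if both of the following hold for all $X\in\Gamma(B)$, $Z\in\Gamma(B')$, $\xi\in\Gamma(\mathrm{Rad}\,TM)$ and $W\in\Gamma(S(TM^\perp))$: (i) $\bar g(\bar h^{l}(X,fZ),\xi)+l\theta(Z)\bar g(\bar JX,\xi)+3m\theta(Z)\bar g(\bar JX,\xi)+m\theta(Z)\bar g(X,\xi)=-\bar g(\bar D^{l}(X,wZ),\xi)+l\theta(\bar JZ)\bar g(X,\xi)+m\theta(\bar JZ)\bar g(\bar JX,\xi)$; (ii) $3\bar g(\bar h^{s}(X,fZ)+\bar\Omega^{s}_XwZ,W)+\bar g(\bar A_{wZ}X,fW)=\bar g(\Omega_XfZ+\bar h^{s}(X,fZ),\bar JW)+\bar g(\bar\Omega^{s}_XwZ,wW)$.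
   Context: Bronze manifold: a semi-Riemannian manifold $(\bar M,\bar g)$ (of constant index $q$, $1\le q\le \dim\bar M-1$) with a $(1,1)$-tensor field $\bar J$ satisfying $\bar J^2=3\bar J+I$ and $\bar g(\bar JX,Y)=\bar g(X,\bar JY)$; it is locally bronze if $\bar\nabla\bar J=0$ for the Levi-Civita connection $\bar\nabla$. Lightlike submanifold: $M\subset\bar M$ such that $\mathrm{Rad}\,TM=TM\cap TM^\perp$ is a distribution of constant rank $r>0$; $g$ is the induced metric. One fixes $S(TM)$, $S(TM^\perp)$ with $TM=\mathrm{Rad}\,TM\perp S(TM)$, $TM^\perp=\mathrm{Rad}\,TM\perp S(TM^\perp)$, and a lightlike transversal bundle $\mathrm{ltr}(TM)$ (locally spanned by $N_1,\dots,N_r$ in $S(TM^\perp)^\perp$, orthogonal to $S(TM)$, with $\bar g(N_i,\xi_j)=\delta_{ij}$, $\bar g(N_i,N_j)=0$ for a local basis $\xi_1,\dots,\xi_r$ of $\mathrm{Rad}\,TM$). Then $T\bar M|_M=TM\oplus \mathrm{tr}(TM)$ with $\mathrm{tr}(TM)=\mathrm{ltr}(TM)\perp S(TM^\perp)$. For $X\in\Gamma(TM)$ write $\bar JX=fX+wX$ with $fX$ tangential and $wX\in\Gamma(\mathrm{tr}(TM))$; likewise for $W\in\Gamma(S(TM^\perp))$, $fW$ and $wW$ denote the tangential and transversal parts of $\bar JW$. Screen generic: $M$ is screen generic if $\bar J(\mathrm{Rad}\,TM)=\mathrm{Rad}\,TM$ and $B_o=\bar J(S(TM))\cap S(TM)$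 is a non-degenerate distribution; $B'$ denotes the complementary (orthogonal) non-degenerate distribution in $S(TM)$, so $S(TM)=B_o\oplus B'$, with (when $B'\neq\{0\}$) $\bar J(B')\not\subseteq S(TM)$ and $\bar J(B')\not\subseteq S(TM^\perp)$, and $fY\in\Gamma(B')$, $wY\in\Gamma(S(TM^\perp))$ for $Y\in\Gamma(B')$. The distribution $B=B_o\perp\mathrm{Rad}\,TM$ is $\bar J$-invariant. $(l,m)$-type connection: let $l,m$ be smooth functions on $\bar M$, $(l,m)\ne(0,0)$, $\eta$ a smooth unit spacelike vector field on $\bar M$, $\theta(X)=\bar g(X,\eta)$. Then $\bar\Omega_XY=\bar\nabla_XY+\theta(Y)\{lX+m\bar JX\}$. Induced objects: for $X,Y\in\Gamma(TM)$, $\bar\Omega_XY=\Omega_XY+\bar h^{l}(X,Y)+\bar h^{s}(X,Y)$ with components in $TM$, $\mathrm{ltr}(TM)$, $S(TM^\perp)$ respectively; for $W\in\Gamma(S(TM^\perp))$, $\bar\Omega_XW=-\bar A_WX+\bar\Omega^s_XW+\bar D^l(X,W)$ with components in $TM$, $S(TM^\perp)$, $\mathrm{ltr}(TM)$ respectively. $M$ is mixed geodesic (with the $(l,m)$-type connection) if $\bar h^{l}(X,Y)=\bar h^{s}(X,Y)=0$ for all $X\in\Gamma(B)$, $Y\in\Gamma(B')$. *)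

theory Defs
  imports "HOL-Analysis.Analysis"
begin

section \<open>Smooth manifolds, tangent vectors and sections\<close>

text \<open>For an open set \<open>S\<close>, \<open>C_diff k S f\<close> says that \<open>f\<close> is of class \<open>C\<^sup>k\<close> on \<open>S\<close>.\<close>

primrec C_diff ::
  "nat \<Rightarrow> 'a::euclidean_space set \<Rightarrow> ('a \<Rightarrow> 'b::real_normed_vector) \<Rightarrow> bool" where
  "C_diff 0 S f \<longleftrightarrow> continuous_on S f"
| "C_diff (Suc k) S f \<longleftrightarrow> (\<forall>x\<in>S. f differentiable (at x)) \<and>
     (\<forall>v. C_diff k S (\<lambda>x. frechet_derivative f (at x) v))"

definition smooth_on :: "'a::euclidean_space set \<Rightarrow> ('a \<Rightarrow> 'b::real_normed_vector) \<Rightarrow> bool" where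
  "smooth_on S f \<longleftrightarrow> (\<forall>k. C_diff k S f)"

text \<open>A chart is a pair of a domain and a coordinate map. The underlying manifold is the whole
  point type, whose topology is required below to be Hausdorff and second countable; its dimension
  is the dimension of the Euclidean model space. Atlases need not be maximal.\<close>

type_synonym ('p, 'e) chart = "'p set \<times> ('p \<Rightarrow> 'e)"

definition param :: "('p, 'e) chart \<Rightarrow> 'e \<Rightarrow> 'p" where
  "param c = inv_into (fst c) (snd c)"

definition smooth_atlas ::
  "('p::{t2_space, second_countable_topology}, 'e::euclidean_space) chart set \<Rightarrow> bool" where
  "smooth_atlas A \<longleftrightarrow>
     (\<Union>c\<in>A. fst c) = UNIV \<and>
     (\<forall>c\<in>A. open (fst c) \<and> open (snd c ` fst c) \<and>
        homeomorphism (fst c) (snd c ` fst c) (snd c) (param c)) \<and>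
     (\<forall>c\<in>A. \<forall>d\<in>A. smooth_on (snd c ` (fst c \<inter> fst d)) (snd d \<circ> param c))"

text \<open>A tangent vector at \<open>p\<close> is represented by its components in the reference chart
  \<open>chart_at A p\<close>, so every tangent space is a copy of the model space. \<open>to_chart A c p v\<close> gives the
  components in a chart \<open>c\<close> around \<open>p\<close> of the vector \<open>v\<close> at \<open>p\<close>. The reference chart may jump
  with \<open>p\<close>, so smoothness of a field is always tested on its components in one fixed chart.\<close>

definition chart_at :: "('p, 'e) chart set \<Rightarrow> 'p \<Rightarrow> ('p, 'e) chart" where
  "chart_at A p = (SOME c. c \<in> A \<and> p \<in> fst c)"

definition to_chart ::
  "('p, 'e::euclidean_space) chart set \<Rightarrow> ('p, 'e) chart \<Rightarrow> 'p \<Rightarrow> 'e \<Rightarrow> 'e" where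
  "to_chart A c p v =
     (let d = chart_at A p in frechet_derivative (snd c \<circ> param d) (at (snd d p)) v)"

definition smooth_fun :: "('p, 'e::euclidean_space) chart set \<Rightarrow> ('p \<Rightarrow> real) \<Rightarrow> bool" where
  "smooth_fun A f \<longleftrightarrow> (\<forall>c\<in>A. smooth_on (snd c ` fst c) (f \<circ> param c))"

definition smooth_map ::
  "('m::topological_space, 'f::euclidean_space) chart set \<Rightarrow>
   ('p::topological_space, 'e::euclidean_space) chart set \<Rightarrow> ('m \<Rightarrow> 'p) \<Rightarrow> bool" where
  "smooth_map A B i \<longleftrightarrow> continuous_on UNIV i \<and>
     (\<forall>c\<in>A. \<forall>d\<in>B. smooth_on (snd c ` (fst c \<inter> i -` fst d)) (snd d \<circ> i \<circ> param c))"

definition tangent_map ::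
  "('m, 'f::euclidean_space) chart set \<Rightarrow> ('p, 'e::euclidean_space) chart set \<Rightarrow>
   ('m \<Rightarrow> 'p) \<Rightarrow> 'm \<Rightarrow> 'f \<Rightarrow> 'e" where
  "tangent_map A B i x v =
     (let c = chart_at A x; d = chart_at B (i x)
      in frechet_derivative (snd d \<circ> i \<circ> param c) (at (snd c x)) v)"

text \<open>The derivative of a function at \<open>p\<close> in the direction of the tangent vector \<open>v\<close>.\<close>

definition dir_deriv ::
  "('p, 'e::euclidean_space) chart set \<Rightarrow> ('p \<Rightarrow> real) \<Rightarrow> 'p \<Rightarrow> 'e \<Rightarrow> real" where
  "dir_deriv A f p v =
     (let c = chart_at A p in frechet_derivative (f \<circ> param c) (at (snd c p)) v)"

text \<open>Smoothness over the open set \<open>W\<close> of a section \<open>Y\<close> of the pull-back of the tangent bundle of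
  the target manifold along \<open>i\<close>; thus \<open>Y x\<close> is a tangent vector at \<open>i x\<close>.\<close>

definition smooth_along ::
  "('m, 'f::euclidean_space) chart set \<Rightarrow> ('p, 'e::euclidean_space) chart set \<Rightarrow>
   ('m \<Rightarrow> 'p) \<Rightarrow> 'm set \<Rightarrow> ('m \<Rightarrow> 'e) \<Rightarrow> bool" where
  "smooth_along A B i W Y \<longleftrightarrow>
     (\<forall>c\<in>A. \<forall>d\<in>B. smooth_on (snd c ` (fst c \<inter> W \<inter> i -` fst d))
        ((\<lambda>x. to_chart B d (i x) (Y x)) \<circ> param c))"

definition vector_fields :: "('p, 'e::euclidean_space) chart set \<Rightarrow> ('p \<Rightarrow> 'e) set" where
  "vector_fields A = {X. smooth_along A A id UNIV X}"


section \<open>Linear connections\<close>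

definition affine_connection ::
  "('p, 'e::euclidean_space) chart set \<Rightarrow> (('p \<Rightarrow> 'e) \<Rightarrow> ('p \<Rightarrow> 'e) \<Rightarrow> 'p \<Rightarrow> 'e) \<Rightarrow> bool" where
  "affine_connection A nab \<longleftrightarrow>
     (\<forall>X\<in>vector_fields A. \<forall>Y\<in>vector_fields A. nab X Y \<in> vector_fields A) \<and>
     (\<forall>X\<in>vector_fields A. \<forall>X'\<in>vector_fields A. \<forall>Y\<in>vector_fields A. \<forall>p.
        nab (\<lambda>p. X p + X' p) Y p = nab X Y p + nab X' Y p) \<and>
     (\<forall>f X Y p. smooth_fun A f \<longrightarrow> X \<in> vector_fields A \<longrightarrow> Y \<in> vector_fields A \<longrightarrow>
        nab (\<lambda>p. f p *\<^sub>R X p) Y p = f p *\<^sub>R nab X Y p) \<and>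
     (\<forall>X\<in>vector_fields A. \<forall>Y\<in>vector_fields A. \<forall>Y'\<in>vector_fields A. \<forall>p.
        nab X (\<lambda>p. Y p + Y' p) p = nab X Y p + nab X Y' p) \<and>
     (\<forall>f X Y p. smooth_fun A f \<longrightarrow> X \<in> vector_fields A \<longrightarrow> Y \<in> vector_fields A \<longrightarrow>
        nab X (\<lambda>p. f p *\<^sub>R Y p) p = dir_deriv A f p (X p) *\<^sub>R Y p + f p *\<^sub>R nab X Y p)"

text \<open>In the torsion condition the Lie bracket enters through its action
  \<open>[X,Y] f = X (Y f) - Y (X f)\<close> on functions.\<close>

definition levi_civita ::
  "('p, 'e::euclidean_space) chart set \<Rightarrow> ('p \<Rightarrow> 'e \<Rightarrow> 'e \<Rightarrow> real) \<Rightarrow>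
   (('p \<Rightarrow> 'e) \<Rightarrow> ('p \<Rightarrow> 'e) \<Rightarrow> 'p \<Rightarrow> 'e) \<Rightarrow> bool" where
  "levi_civita A g nab \<longleftrightarrow> affine_connection A nab \<and>
     (\<forall>X\<in>vector_fields A. \<forall>Y\<in>vector_fields A. \<forall>f p. smooth_fun A f \<longrightarrow>
        dir_deriv A f p (nab X Y p - nab Y X p) =
        dir_deriv A (\<lambda>q. dir_deriv A f q (Y q)) p (X p) -
        dir_deriv A (\<lambda>q. dir_deriv A f q (X q)) p (Y p)) \<and>
     (\<forall>X\<in>vector_fields A. \<forall>Y\<in>vector_fields A. \<forall>Z\<in>vector_fields A. \<forall>p.
        dir_deriv A (\<lambda>q. g q (Y q) (Z q)) p (X p) =
        g p (nab X Y p) (Z p) + g p (Y p) (nab X Z p))"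


section \<open>Bronze semi-Riemannian manifolds\<close>

record ('p, 'e) bronze_data =
  atlas :: "('p, 'e) chart set"
  metric :: "'p \<Rightarrow> 'e \<Rightarrow> 'e \<Rightarrow> real"
  bronze :: "'p \<Rightarrow> 'e \<Rightarrow> 'e"

definition nondegenerate_on :: "'e::real_vector set \<Rightarrow> ('e \<Rightarrow> 'e \<Rightarrow> real) \<Rightarrow> bool" where
  "nondegenerate_on V b \<longleftrightarrow> (\<forall>u\<in>V. (\<forall>v\<in>V. b u v = 0) \<longrightarrow> u = 0)"

definition form_index :: "('e::euclidean_space \<Rightarrow> 'e \<Rightarrow> real) \<Rightarrow> nat" where
  "form_index b = Max {dim V | V. subspace V \<and> (\<forall>v\<in>V. v \<noteq> 0 \<longrightarrow> b v v < 0)}"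

definition semi_riemannian_metric ::
  "('p, 'e::euclidean_space) chart set \<Rightarrow> ('p \<Rightarrow> 'e \<Rightarrow> 'e \<Rightarrow> real) \<Rightarrow> nat \<Rightarrow> bool" where
  "semi_riemannian_metric A g q \<longleftrightarrow>
     (\<forall>p. bilinear (g p) \<and> (\<forall>u v. g p u v = g p v u) \<and> nondegenerate_on UNIV (g p) \<and>
        form_index (g p) = q) \<and>
     (\<forall>X\<in>vector_fields A. \<forall>Y\<in>vector_fields A. smooth_fun A (\<lambda>p. g p (X p) (Y p)))"

definition bronze_manifold ::
  "('p::{t2_space, second_countable_topology}, 'e::euclidean_space) bronze_data \<Rightarrow> nat \<Rightarrow> bool" where
  "bronze_manifold N q \<longleftrightarrow>
     smooth_atlas (atlas N) \<and>
     semi_riemannian_metric (atlas N) (metric N) q \<and> 1 \<le> q \<and> q \<le> DIM('e) - 1 \<and>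
     (\<forall>p. linear (bronze N p)) \<and>
     (\<forall>X\<in>vector_fields (atlas N). (\<lambda>p. bronze N p (X p)) \<in> vector_fields (atlas N)) \<and>
     (\<forall>p v. bronze N p (bronze N p v) = 3 *\<^sub>R bronze N p v + v) \<and>
     (\<forall>p u v. metric N p (bronze N p u) v = metric N p u (bronze N p v))"

definition locally_bronze ::
  "('p::{t2_space, second_countable_topology}, 'e::euclidean_space) bronze_data \<Rightarrow> nat \<Rightarrow>
   (('p \<Rightarrow> 'e) \<Rightarrow> ('p \<Rightarrow> 'e) \<Rightarrow> 'p \<Rightarrow> 'e) \<Rightarrow> bool" where
  "locally_bronze N q nab \<longleftrightarrow> bronze_manifold N q \<and> levi_civita (atlas N) (metric N) nab \<and>
     (\<forall>X\<in>vector_fields (atlas N). \<forall>Y\<in>vector_fields (atlas N). \<forall>p.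
        nab X (\<lambda>p. bronze N p (Y p)) p = bronze N p (nab X Y p))"

definition lm_connection_data ::
  "('p, 'e::euclidean_space) bronze_data \<Rightarrow>
   ('p \<Rightarrow> real) \<Rightarrow> ('p \<Rightarrow> real) \<Rightarrow> ('p \<Rightarrow> 'e) \<Rightarrow> bool" where
  "lm_connection_data N l m \<eta> \<longleftrightarrow>
     smooth_fun (atlas N) l \<and> smooth_fun (atlas N) m \<and> (l, m) \<noteq> ((\<lambda>_. 0), (\<lambda>_. 0)) \<and>
     \<eta> \<in> vector_fields (atlas N) \<and> (\<forall>p. metric N p (\<eta> p) (\<eta> p) = 1)"

definition \<theta>_form ::
  "('p, 'e) bronze_data \<Rightarrow> ('p \<Rightarrow> 'e) \<Rightarrow> 'p \<Rightarrow> 'e \<Rightarrow> real" where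
  "\<theta>_form N \<eta> p v = metric N p v (\<eta> p)"

definition lm_connection ::
  "('p, 'e::euclidean_space) bronze_data \<Rightarrow> (('p \<Rightarrow> 'e) \<Rightarrow> ('p \<Rightarrow> 'e) \<Rightarrow> 'p \<Rightarrow> 'e) \<Rightarrow>
   ('p \<Rightarrow> real) \<Rightarrow> ('p \<Rightarrow> real) \<Rightarrow> ('p \<Rightarrow> 'e) \<Rightarrow>
   ('p \<Rightarrow> 'e) \<Rightarrow> ('p \<Rightarrow> 'e) \<Rightarrow> 'p \<Rightarrow> 'e" where
  "lm_connection N nab l m \<eta> X Y p =
     nab X Y p + \<theta>_form N \<eta> p (Y p) *\<^sub>R (l p *\<^sub>R X p + m p *\<^sub>R bronze N p (X p))"


section \<open>Lightlike submanifolds\<close>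

text \<open>A submanifold is given by an injective immersion of a manifold of its own (point type
  \<open>'m\<close>, model space \<open>'f\<close>); embedded submanifolds are the special case where the topology is induced.
  All bundles over it are families of subspaces of the ambient tangent spaces at the points \<open>imm x\<close>,
  and their sections are vector fields along the immersion.\<close>

record ('m, 'f, 'p, 'e) lightlike_data =
  sub_atlas :: "('m, 'f) chart set"
  imm :: "'m \<Rightarrow> 'p"
  screen :: "'m \<Rightarrow> 'e set"                \<comment> \<open>\<open>S(TM)\<close>\<close>
  screen_transversal :: "'m \<Rightarrow> 'e set"    \<comment> \<open>\<open>S(TM\<^sup>\<bottom>)\<close>\<close>
  ltr :: "'m \<Rightarrow> 'e set"                   \<comment> \<open>\<open>ltr(TM)\<close>\<close>

definition metric_on ::
  "('p, 'e) bronze_data \<Rightarrow> ('m, 'f, 'p, 'e) lightlike_data \<Rightarrow> 'm \<Rightarrow> 'e \<Rightarrow> 'e \<Rightarrow> real" where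
  "metric_on N M x = metric N (imm M x)"

definition bronze_on ::
  "('p, 'e) bronze_data \<Rightarrow> ('m, 'f, 'p, 'e) lightlike_data \<Rightarrow> 'm \<Rightarrow> 'e \<Rightarrow> 'e" where
  "bronze_on N M x = bronze N (imm M x)"

definition immersion_at ::
  "('p, 'e::euclidean_space) bronze_data \<Rightarrow> ('m, 'f::euclidean_space, 'p, 'e) lightlike_data \<Rightarrow>
   'm \<Rightarrow> 'f \<Rightarrow> 'e" where
  "immersion_at N M = tangent_map (sub_atlas M) (atlas N) (imm M)"

definition tangent ::
  "('p, 'e::euclidean_space) bronze_data \<Rightarrow> ('m, 'f::euclidean_space, 'p, 'e) lightlike_data \<Rightarrow>
   'm \<Rightarrow> 'e set" where
  "tangent N M x = range (immersion_at N M x)"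

definition normal ::
  "('p, 'e::euclidean_space) bronze_data \<Rightarrow> ('m, 'f::euclidean_space, 'p, 'e) lightlike_data \<Rightarrow>
   'm \<Rightarrow> 'e set" where
  "normal N M x = {v. \<forall>u\<in>tangent N M x. metric_on N M x u v = 0}"

definition Rad ::
  "('p, 'e::euclidean_space) bronze_data \<Rightarrow> ('m, 'f::euclidean_space, 'p, 'e) lightlike_data \<Rightarrow>
   'm \<Rightarrow> 'e set" where
  "Rad N M x = tangent N M x \<inter> normal N M x"

definition smooth_over ::
  "('p, 'e::euclidean_space) bronze_data \<Rightarrow> ('m, 'f::euclidean_space, 'p, 'e) lightlike_data \<Rightarrow>
   'm set \<Rightarrow> ('m \<Rightarrow> 'e) \<Rightarrow> bool" where
  "smooth_over N M W Y = smooth_along (sub_atlas M) (atlas N) (imm M) W Y"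

definition sections ::
  "('p, 'e::euclidean_space) bronze_data \<Rightarrow> ('m, 'f::euclidean_space, 'p, 'e) lightlike_data \<Rightarrow>
   ('m \<Rightarrow> 'e set) \<Rightarrow> ('m \<Rightarrow> 'e) set" where
  "sections N M E = {Y. smooth_over N M UNIV Y \<and> (\<forall>x. Y x \<in> E x)}"

text \<open>Smooth subbundles of rank \<open>k\<close>: the spanning sections are linearly independent because
  the fibres have dimension \<open>k\<close>.\<close>

definition smooth_bundle ::
  "('p, 'e::euclidean_space) bronze_data \<Rightarrow>
   ('m::topological_space, 'f::euclidean_space, 'p, 'e) lightlike_data \<Rightarrow>
   ('m \<Rightarrow> 'e set) \<Rightarrow> nat \<Rightarrow> bool" where
  "smooth_bundle N M E k \<longleftrightarrow>
     (\<forall>x. subspace (E x) \<and> dim (E x) = k) \<and>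
     (\<forall>x. \<exists>W s. open W \<and> x \<in> W \<and> (\<forall>j<k. smooth_over N M W (s j)) \<and>
        (\<forall>y\<in>W. E y = span ((\<lambda>j. s j y) ` {..<k})))"

definition orthogonal_sum ::
  "('e::real_vector \<Rightarrow> 'e \<Rightarrow> real) \<Rightarrow> 'e set \<Rightarrow> 'e set \<Rightarrow> 'e set \<Rightarrow> bool" where
  "orthogonal_sum b V U1 U2 \<longleftrightarrow>
     V = {u + v | u v. u \<in> U1 \<and> v \<in> U2} \<and> U1 \<inter> U2 = {0} \<and> (\<forall>u\<in>U1. \<forall>v\<in>U2. b u v = 0)"

definition lightlike_transversal ::
  "('p, 'e::euclidean_space) bronze_data \<Rightarrow>
   ('m::topological_space, 'f::euclidean_space, 'p, 'e) lightlike_data \<Rightarrow> nat \<Rightarrow> bool" where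
  "lightlike_transversal N M r \<longleftrightarrow> smooth_bundle N M (ltr M) r \<and>
     (\<forall>x. \<exists>W \<xi> n. open W \<and> x \<in> W \<and>
        (\<forall>j<r. smooth_over N M W (\<xi> j) \<and> smooth_over N M W (n j)) \<and>
        (\<forall>y\<in>W. Rad N M y = span ((\<lambda>j. \<xi> j y) ` {..<r}) \<and>
           ltr M y = span ((\<lambda>j. n j y) ` {..<r}) \<and>
           (\<forall>i<r. \<forall>j<r. metric_on N M y (n i y) (\<xi> j y) = (if i = j then 1 else 0) \<and>
              metric_on N M y (n i y) (n j y) = 0) \<and>
           (\<forall>i<r. \<forall>u \<in> screen M y \<union> screen_transversal M y. metric_on N M y (n i y) u = 0)))"

definition lightlike_submanifold ::
  "('p::{t2_space, second_countable_topology}, 'e::euclidean_space) bronze_data \<Rightarrow>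
   ('m::{t2_space, second_countable_topology}, 'f::euclidean_space, 'p, 'e) lightlike_data \<Rightarrow>
   nat \<Rightarrow> bool" where
  "lightlike_submanifold N M r \<longleftrightarrow>
     smooth_atlas (sub_atlas M) \<and> smooth_map (sub_atlas M) (atlas N) (imm M) \<and>
     inj (imm M) \<and> (\<forall>x. inj (immersion_at N M x)) \<and>
     r > 0 \<and> smooth_bundle N M (Rad N M) r \<and>
     (\<exists>k. smooth_bundle N M (screen M) k) \<and>
     (\<forall>x. orthogonal_sum (metric_on N M x) (tangent N M x) (Rad N M x) (screen M x)) \<and>
     (\<exists>k. smooth_bundle N M (screen_transversal M) k) \<and>
     (\<forall>x. orthogonal_sum (metric_on N M x) (normal N M x) (Rad N M x) (screen_transversal M x)) \<and>
     lightlike_transversal N M r"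

text \<open>\<open>along_connection N M nab C\<close>: \<open>C\<close> is the connection along the immersion induced by the
  connection \<open>nab\<close> of the ambient manifold, i.e. \<open>C X Y\<close> is the derivative of \<open>Y\<close>, a section over \<open>M\<close>
  of the ambient tangent bundle, in the direction of a tangent field \<open>X\<close> of \<open>M\<close>. The last clause says
  that \<open>C\<close> agrees with \<open>nab\<close> on restrictions of ambient fields; together with the other clauses
  it determines \<open>C\<close>.\<close>

definition along_connection ::
  "('p, 'e::euclidean_space) bronze_data \<Rightarrow> ('m, 'f::euclidean_space, 'p, 'e) lightlike_data \<Rightarrow>
   (('p \<Rightarrow> 'e) \<Rightarrow> ('p \<Rightarrow> 'e) \<Rightarrow> 'p \<Rightarrow> 'e) \<Rightarrow> (('m \<Rightarrow> 'e) \<Rightarrow> ('m \<Rightarrow> 'e) \<Rightarrow> 'm \<Rightarrow> 'e) \<Rightarrow> bool" where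
  "along_connection N M nab C \<longleftrightarrow>
     (let TM = sections N M (tangent N M); TN = sections N M (\<lambda>_. UNIV) in
     (\<forall>X\<in>TM. \<forall>Y\<in>TN. C X Y \<in> TN) \<and>
     (\<forall>X\<in>TM. \<forall>X'\<in>TM. \<forall>Y\<in>TN. \<forall>x. C (\<lambda>x. X x + X' x) Y x = C X Y x + C X' Y x) \<and>
     (\<forall>f X Y x. smooth_fun (sub_atlas M) f \<longrightarrow> X \<in> TM \<longrightarrow> Y \<in> TN \<longrightarrow>
        C (\<lambda>x. f x *\<^sub>R X x) Y x = f x *\<^sub>R C X Y x) \<and>
     (\<forall>X\<in>TM. \<forall>Y\<in>TN. \<forall>Y'\<in>TN. \<forall>x. C X (\<lambda>x. Y x + Y' x) x = C X Y x + C X Y' x) \<and>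
     (\<forall>f X Y x v. smooth_fun (sub_atlas M) f \<longrightarrow> X \<in> TM \<longrightarrow> Y \<in> TN \<longrightarrow>
        immersion_at N M x v = X x \<longrightarrow>
        C X (\<lambda>x. f x *\<^sub>R Y x) x = dir_deriv (sub_atlas M) f x v *\<^sub>R Y x + f x *\<^sub>R C X Y x) \<and>
     (\<forall>X\<in>TM. \<forall>X'\<in>vector_fields (atlas N). \<forall>Y'\<in>vector_fields (atlas N). \<forall>x.
        X' (imm M x) = X x \<longrightarrow> C X (\<lambda>x. Y' (imm M x)) x = nab X' Y' (imm M x)))"


section \<open>Components and induced objects\<close>

definition component ::
  "'e::real_vector set \<Rightarrow> 'e set \<Rightarrow> 'e set \<Rightarrow> 'e \<Rightarrow> 'e" where
  "component U V W v = (THE a. a \<in> U \<and> (\<exists>b\<in>V. \<exists>c\<in>W. v = a + b + c))"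

definition tan_part ::
  "('p, 'e::euclidean_space) bronze_data \<Rightarrow> ('m, 'f::euclidean_space, 'p, 'e) lightlike_data \<Rightarrow>
   'm \<Rightarrow> 'e \<Rightarrow> 'e" where
  "tan_part N M x = component (tangent N M x) (ltr M x) (screen_transversal M x)"

definition ltr_part ::
  "('p, 'e::euclidean_space) bronze_data \<Rightarrow> ('m, 'f::euclidean_space, 'p, 'e) lightlike_data \<Rightarrow>
   'm \<Rightarrow> 'e \<Rightarrow> 'e" where
  "ltr_part N M x = component (ltr M x) (tangent N M x) (screen_transversal M x)"

definition str_part ::
  "('p, 'e::euclidean_space) bronze_data \<Rightarrow> ('m, 'f::euclidean_space, 'p, 'e) lightlike_data \<Rightarrow>
   'm \<Rightarrow> 'e \<Rightarrow> 'e" where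
  "str_part N M x = component (screen_transversal M x) (tangent N M x) (ltr M x)"

definition f_part ::
  "('p, 'e::euclidean_space) bronze_data \<Rightarrow> ('m, 'f::euclidean_space, 'p, 'e) lightlike_data \<Rightarrow>
   ('m \<Rightarrow> 'e) \<Rightarrow> 'm \<Rightarrow> 'e" where
  "f_part N M Y x = tan_part N M x (bronze_on N M x (Y x))"

definition w_part ::
  "('p, 'e::euclidean_space) bronze_data \<Rightarrow> ('m, 'f::euclidean_space, 'p, 'e) lightlike_data \<Rightarrow>
   ('m \<Rightarrow> 'e) \<Rightarrow> 'm \<Rightarrow> 'e" where
  "w_part N M Y x =
     ltr_part N M x (bronze_on N M x (Y x)) + str_part N M x (bronze_on N M x (Y x))"

text \<open>The objects induced by a connection \<open>C\<close> along the immersion. For \<open>X\<close>, \<open>Y\<close> tangent to \<open>M\<close>,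
  \<open>C X Y = ind_conn X Y + h_l X Y + h_s X Y\<close>; for a section \<open>W\<close> of the screen transversal bundle,
  \<open>C X W = - shape W X + conn_s X W + D_l X W\<close>.\<close>

definition ind_conn where
  "ind_conn N M C X Y x = tan_part N M x (C X Y x)"

definition h_l where
  "h_l N M C X Y x = ltr_part N M x (C X Y x)"

definition h_s where
  "h_s N M C X Y x = str_part N M x (C X Y x)"

definition shape where
  "shape N M C W X x = - tan_part N M x (C X W x)"

definition conn_s where
  "conn_s N M C X W x = str_part N M x (C X W x)"

definition D_l where
  "D_l N M C X W x = ltr_part N M x (C X W x)"


section \<open>Screen generic and mixed geodesic submanifolds\<close>

definition B_o ::
  "('p, 'e::euclidean_space) bronze_data \<Rightarrow> ('m, 'f::euclidean_space, 'p, 'e) lightlike_data \<Rightarrow>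
   'm \<Rightarrow> 'e set" where
  "B_o N M x = bronze_on N M x ` screen M x \<inter> screen M x"

definition B_prime ::
  "('p, 'e::euclidean_space) bronze_data \<Rightarrow> ('m, 'f::euclidean_space, 'p, 'e) lightlike_data \<Rightarrow>
   'm \<Rightarrow> 'e set" where
  "B_prime N M x = {v \<in> screen M x. \<forall>u\<in>B_o N M x. metric_on N M x u v = 0}"

definition B_inv ::
  "('p, 'e::euclidean_space) bronze_data \<Rightarrow> ('m, 'f::euclidean_space, 'p, 'e) lightlike_data \<Rightarrow>
   'm \<Rightarrow> 'e set" where
  "B_inv N M x = {u + v | u v. u \<in> B_o N M x \<and> v \<in> Rad N M x}"

definition screen_generic ::
  "('p::{t2_space, second_countable_topology}, 'e::euclidean_space) bronze_data \<Rightarrow>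
   ('m::{t2_space, second_countable_topology}, 'f::euclidean_space, 'p, 'e) lightlike_data \<Rightarrow>
   nat \<Rightarrow> bool" where
  "screen_generic N M r \<longleftrightarrow> lightlike_submanifold N M r \<and>
     (\<forall>x. bronze_on N M x ` Rad N M x = Rad N M x) \<and>
     (\<exists>k. smooth_bundle N M (B_o N M) k) \<and>
     (\<forall>x. nondegenerate_on (B_o N M x) (metric_on N M x)) \<and>
     ((\<exists>x. B_prime N M x \<noteq> {0}) \<longrightarrow>
        \<not> (\<forall>x. bronze_on N M x ` B_prime N M x \<subseteq> screen M x) \<and>
        \<not> (\<forall>x. bronze_on N M x ` B_prime N M x \<subseteq> screen_transversal M x)) \<and>
     (\<forall>Y \<in> sections N M (B_prime N M).
        f_part N M Y \<in> sections N M (B_prime N M) \<and>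
        w_part N M Y \<in> sections N M (screen_transversal M))"

definition mixed_geodesic ::
  "('p, 'e::euclidean_space) bronze_data \<Rightarrow> ('m, 'f::euclidean_space, 'p, 'e) lightlike_data \<Rightarrow>
   (('m \<Rightarrow> 'e) \<Rightarrow> ('m \<Rightarrow> 'e) \<Rightarrow> 'm \<Rightarrow> 'e) \<Rightarrow> bool" where
  "mixed_geodesic N M C \<longleftrightarrow>
     (\<forall>X \<in> sections N M (B_inv N M). \<forall>Y \<in> sections N M (B_prime N M). \<forall>x.
        h_l N M C X Y x = 0 \<and> h_s N M C X Y x = 0)"

end

theory Submission
  imports Defs "HOL-Computational_Algebra.Polynomial"
begin

text \<open>Put \<open>K = lX + mJX\<close>, which lies in \<open>B\<close>. From \<open>\<nabla>J = 0\<close> one gets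
  \<open>\<Omega>\<^sub>X JZ = J \<Omega>\<^sub>X Z + \<theta>(JZ) K - \<theta>(Z) JK\<close>, and \<open>K\<close>, \<open>JK\<close> are tangent because \<open>B\<close> is invariant.
  Since \<open>\<xi>\<close> is radical, (i) says that \<open>g(\<Omega>\<^sub>X JZ, \<xi>) = g(h\<^sup>l(X,Z), J\<xi>)\<close> vanishes, and \<open>J\<close> maps the
  radical onto itself; so (i) for all \<open>\<xi>\<close> means \<open>h\<^sup>l(X,Z) = 0\<close>, and also that \<open>\<Omega>\<^sub>X JZ\<close> has no lightlike
  transversal part. Given this, (ii) becomes \<open>3 g(\<Omega>\<^sub>X JZ, W) = g(\<Omega>\<^sub>X JZ, JW)\<close>, i.e.
  \<open>g(J\<^sup>-\<^sup>1 \<Omega>\<^sub>X JZ, W) = g(h\<^sup>s(X,Z), W) = 0\<close> by \<open>J\<^sup>-\<^sup>1 = J - 3\<close>. To pass from sections to vectors, each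
  vector of a bundle is extended to a global section by a bump function.\<close>


section \<open>Calculus of smooth maps\<close>

text \<open>On an open set the two functions agree near each point, so their derivatives agree as
  well and the induction passes to the derivatives.\<close>

lemma C_diff_cong:
  assumes "open S" "\<And>x. x \<in> S \<Longrightarrow> f x = g x" "C_diff k S f"
  shows "C_diff k S g"
  using assms(2,3)
proof (induction k arbitrary: f g)
  case 0
  then show ?case by (metis C_diff.simps(1) continuous_on_cong)
next
  case (Suc k)
  have hd: "(g has_derivative frechet_derivative f (at x)) (at x)" if "x \<in> S" for x
    using has_derivative_transform_within_open[OF _ \<open>open S\<close> that] Suc.prems that
    by (metis C_diff.simps(2) frechet_derivative_works)
  have eq: "frechet_derivative f (at x) = frechet_derivative g (at x)" if "x \<in> S" for x
    using frechet_derivative_at[OF hd[OF that]] by simp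
  have "C_diff k S (\<lambda>x. frechet_derivative g (at x) v)" for v
    by (rule Suc.IH[of "\<lambda>x. frechet_derivative f (at x) v"]) (use eq Suc.prems in auto)
  then show ?case
    using hd by (auto simp: differentiable_def)
qed

text \<open>Allows a known derivative formula in place of \<open>frechet_derivative\<close>; the
  closure rules below obtain their induction steps from it.\<close>

lemma C_diff_SucI:
  assumes "open S" and der: "\<And>x. x \<in> S \<Longrightarrow> (f has_derivative f' x) (at x)"
    and "\<And>v. C_diff k S (\<lambda>x. f' x v)"
  shows "C_diff (Suc k) S f"
proof -
  have "C_diff k S (\<lambda>x. frechet_derivative f (at x) v)" for v
    by (rule C_diff_cong[OF \<open>open S\<close> _ assms(3)]) (use frechet_derivative_at[OF der] in auto)
  then show ?thesis
    using der by (auto simp: differentiable_def)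
qed

lemma C_diff_Suc_deriv:
  assumes "C_diff (Suc k) S f" "x \<in> S"
  shows "(f has_derivative frechet_derivative f (at x)) (at x)"
  using assms by (simp add: frechet_derivative_works)

lemma C_diff_SucD: "C_diff (Suc k) S f \<Longrightarrow> C_diff k S f"
proof (induction k arbitrary: f)
  case 0
  then show ?case
    by (auto intro!: differentiable_imp_continuous_within continuous_at_imp_continuous_on)
next
  case (Suc k)
  then show ?case by (metis C_diff.simps(2))
qed

lemma C_diff_subset: "C_diff k S f \<Longrightarrow> T \<subseteq> S \<Longrightarrow> C_diff k T f"
  by (induction k arbitrary: f) (auto intro: continuous_on_subset)

lemma C_diff_local:
  assumes "\<And>x. x \<in> S \<Longrightarrow> \<exists>U. open U \<and> x \<in> U \<and> C_diff k U f"
  shows "C_diff k S f"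
  using assms
proof (induction k arbitrary: f)
  case 0
  then show ?case
    unfolding C_diff.simps
    by (intro continuous_at_imp_continuous_on ballI) (blast dest: continuous_on_eq_continuous_at)
next
  case (Suc k)
  show ?case
    unfolding C_diff.simps
  proof (intro conjI ballI allI)
    show "f differentiable at x" if "x \<in> S" for x
      using Suc.prems[OF that] by auto
    show "C_diff k S (\<lambda>x. frechet_derivative f (at x) v)" for v
    proof (rule Suc.IH)
      fix x
      assume "x \<in> S"
      then obtain U where "open U" "x \<in> U" "C_diff (Suc k) U f" using Suc.prems by blast
      then show "\<exists>U. open U \<and> x \<in> U \<and> C_diff k U (\<lambda>x. frechet_derivative f (at x) v)" by auto
    qed
  qed
qed

lemma C_diff_const: "open S \<Longrightarrow> C_diff k S (\<lambda>x. c)"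
proof (induction k arbitrary: c)
  case (Suc k)
  then show ?case by (intro C_diff_SucI[where f' = "\<lambda>_ _. 0"]) auto
qed auto

lemma C_diff_bounded_linear:
  assumes "open S" "bounded_linear L"
  shows "C_diff k S f \<Longrightarrow> C_diff k S (\<lambda>x. L (f x))"
proof (induction k arbitrary: f)
  case 0
  then show ?case
    using bounded_linear.continuous_on[OF assms(2)] by auto
next
  case (Suc k)
  show ?case
    by (rule C_diff_SucI[OF \<open>open S\<close>
          bounded_linear.has_derivative[OF assms(2) C_diff_Suc_deriv[OF Suc.prems]]])
      (use Suc in auto)
qed

lemma C_diff_ident: "open S \<Longrightarrow> C_diff k S (\<lambda>x. x)"
proof (cases k)
  case (Suc j)
  assume "open S"
  then show ?thesis
    unfolding Suc by (intro C_diff_SucI[where f' = "\<lambda>_ v. v"] C_diff_const) auto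
qed auto

lemma C_diff_add:
  assumes "open S"
  shows "C_diff k S f \<Longrightarrow> C_diff k S g \<Longrightarrow> C_diff k S (\<lambda>x. f x + g x)"
proof (induction k arbitrary: f g)
  case 0
  then show ?case by (auto intro: continuous_on_add)
next
  case (Suc k)
  show ?case
    by (rule C_diff_SucI[OF \<open>open S\<close> has_derivative_add[OF
          C_diff_Suc_deriv[OF Suc.prems(1)] C_diff_Suc_deriv[OF Suc.prems(2)]]])
      (use Suc in auto)
qed

lemma C_diff_sum:
  assumes "open S" "\<And>i. i \<in> I \<Longrightarrow> C_diff k S (f i)"
  shows "C_diff k S (\<lambda>x. \<Sum>i\<in>I. f i x)"
proof (cases "finite I")
  case True
  then show ?thesis
    using assms(2) by (induction I) (auto intro: C_diff_const C_diff_add assms(1))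
qed (auto intro: C_diff_const assms(1))

text \<open>The Leibniz rule leaves one factor undifferentiated in each term, so the induction step
  also needs both factors one order lower, which \<open>C_diff_SucD\<close> supplies.\<close>

lemma C_diff_bilinear:
  assumes "open S" "bounded_bilinear p"
  shows "C_diff k S f \<Longrightarrow> C_diff k S g \<Longrightarrow> C_diff k S (\<lambda>x. p (f x) (g x))"
proof (induction k arbitrary: f g)
  case 0
  then show ?case using bounded_bilinear.continuous_on[OF assms(2)] by auto
next
  case (Suc k)
  have "C_diff k S f" "C_diff k S g"
    by (rule C_diff_SucD[OF Suc.prems(1)], rule C_diff_SucD[OF Suc.prems(2)])
  then show ?case
    by (intro C_diff_SucI[OF \<open>open S\<close> bounded_bilinear.FDERIV[OF assms(2)
          C_diff_Suc_deriv[OF Suc.prems(1)] C_diff_Suc_deriv[OF Suc.prems(2)]]])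
      (use Suc.prems in \<open>auto intro!: C_diff_add assms(1) Suc.IH\<close>)
qed

lemma C_diff_compose:
  fixes f :: "'a::euclidean_space \<Rightarrow> 'b::euclidean_space"
    and g :: "'b \<Rightarrow> 'c::real_normed_vector"
  assumes "open S" "open T" "f ` S \<subseteq> T"
  shows "C_diff k S f \<Longrightarrow> C_diff k T g \<Longrightarrow> C_diff k S (\<lambda>x. g (f x))"
proof (induction k arbitrary: g)
  case 0
  then show ?case using assms(3) by (auto intro: continuous_on_compose2)
next
  case (Suc k)
  have fT: "f x \<in> T" if "x \<in> S" for x using assms(3) that by auto
  have lin: "linear (frechet_derivative g (at (f x)))" if "x \<in> S" for x
    using C_diff_Suc_deriv[OF Suc.prems(2) fT[OF that]] has_derivative_linear by blast
  \<comment> \<open>In the chain rule the direction fed into the derivative of \<open>g\<close>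
    varies with \<open>x\<close>, but \<open>C_diff\<close> speaks of fixed directions only.
    Expanding in the basis leaves fixed directions with variable scalar coefficients.\<close>
  have expand: "frechet_derivative g (at (f x)) (frechet_derivative f (at x) v) =
      (\<Sum>b\<in>Basis. (frechet_derivative f (at x) v \<bullet> b) *\<^sub>R frechet_derivative g (at (f x)) b)"
    if "x \<in> S" for x v
    by (subst euclidean_representation[of "frechet_derivative f (at x) v", symmetric])
      (simp add: linear_sum[OF lin[OF that]] linear_cmul[OF lin[OF that]])
  have IH: "C_diff k S (\<lambda>x. frechet_derivative g (at (f x)) b)" for b
    using Suc.prems(2) by (intro Suc.IH[OF C_diff_SucD[OF Suc.prems(1)]]) simp
  have fc: "C_diff k S (\<lambda>x. frechet_derivative f (at x) v \<bullet> b)" for v b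
    using Suc.prems(1) by (intro C_diff_bounded_linear[OF assms(1) bounded_linear_inner_left]) simp
  show ?case
  proof (rule C_diff_SucI[OF assms(1)])
    show "((\<lambda>x. g (f x)) has_derivative
        (\<lambda>v. frechet_derivative g (at (f x)) (frechet_derivative f (at x) v))) (at x)"
      if "x \<in> S" for x
      using diff_chain_at[OF C_diff_Suc_deriv[OF Suc.prems(1) that]
          C_diff_Suc_deriv[OF Suc.prems(2) fT[OF that]]] by (simp add: o_def)
    show "C_diff k S (\<lambda>x. frechet_derivative g (at (f x)) (frechet_derivative f (at x) v))" for v
      by (rule C_diff_cong[OF assms(1) expand[symmetric]])
        (auto intro!: C_diff_sum C_diff_bilinear[OF assms(1) bounded_bilinear_scaleR] assms(1) fc IH)
  qed
qed

section \<open>Closure rules for maps of class C^k for every k\<close>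

lemma smooth_on_cong:
  "open S \<Longrightarrow> (\<And>x. x \<in> S \<Longrightarrow> f x = g x) \<Longrightarrow> smooth_on S f \<Longrightarrow> smooth_on S g"
  by (metis C_diff_cong smooth_on_def)

lemma smooth_on_subset: "smooth_on S f \<Longrightarrow> T \<subseteq> S \<Longrightarrow> smooth_on T f"
  by (metis C_diff_subset smooth_on_def)

lemma smooth_on_local:
  "(\<And>x. x \<in> S \<Longrightarrow> \<exists>U. open U \<and> x \<in> U \<and> smooth_on U f) \<Longrightarrow> smooth_on S f"
  unfolding smooth_on_def by (meson C_diff_local)

lemma smooth_on_Un:
  "open S \<Longrightarrow> open T \<Longrightarrow> smooth_on S f \<Longrightarrow> smooth_on T f \<Longrightarrow> smooth_on (S \<union> T) f"
  by (rule smooth_on_local) blast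

lemma smooth_on_const: "open S \<Longrightarrow> smooth_on S (\<lambda>x. c)"
  by (simp add: smooth_on_def C_diff_const)

lemma smooth_on_bounded_linear:
  "open S \<Longrightarrow> bounded_linear L \<Longrightarrow> smooth_on S f \<Longrightarrow> smooth_on S (\<lambda>x. L (f x))"
  by (simp add: smooth_on_def C_diff_bounded_linear)

lemma smooth_on_add:
  "open S \<Longrightarrow> smooth_on S f \<Longrightarrow> smooth_on S g \<Longrightarrow> smooth_on S (\<lambda>x. f x + g x)"
  by (simp add: smooth_on_def C_diff_add)

lemma smooth_on_scaleR:
  "open S \<Longrightarrow> smooth_on S f \<Longrightarrow> smooth_on S g \<Longrightarrow> smooth_on S (\<lambda>x. f x *\<^sub>R g x)"
  by (simp add: smooth_on_def C_diff_bilinear bounded_bilinear_scaleR)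

lemma smooth_on_compose:
  fixes f :: "'a::euclidean_space \<Rightarrow> 'b::euclidean_space"
  shows "open S \<Longrightarrow> open T \<Longrightarrow> f ` S \<subseteq> T \<Longrightarrow> smooth_on S f \<Longrightarrow> smooth_on T g \<Longrightarrow>
    smooth_on S (\<lambda>x. g (f x))"
  by (simp add: smooth_on_def C_diff_compose)

lemma smooth_on_differentiable: "smooth_on S f \<Longrightarrow> x \<in> S \<Longrightarrow> f differentiable at x"
  by (metis C_diff.simps(2) smooth_on_def)

lemma smooth_on_frechet_derivative:
  "smooth_on S f \<Longrightarrow> smooth_on S (\<lambda>x. frechet_derivative f (at x) v)"
  by (metis C_diff.simps(2) smooth_on_def)


section \<open>Bump functions\<close>

text \<open>The family is closed under differentiation, so all members are smooth by one induction.\<close>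

definition flat_fun :: "real poly \<Rightarrow> real \<Rightarrow> real" where
  "flat_fun P t = (if t > 0 then poly P (1 / t) * exp (- 1 / t) else 0)"

text \<open>Term by term, exponential growth beats every power. After the substitution of
  \<open>1 / t\<close> this is the flatness of \<open>flat_fun\<close> at 0.\<close>

lemma poly_exp_minus_tendsto_0: "((\<lambda>x. poly P x * exp (- x)) \<longlongrightarrow> (0::real)) at_top"
proof -
  have "((\<lambda>x. \<Sum>i\<le>degree P. coeff P i * (x ^ i / exp x)) \<longlongrightarrow> (\<Sum>i\<le>degree P. coeff P i * 0)) at_top"
    by (intro tendsto_intros tendsto_power_div_exp_0)
  then show ?thesis
    by (simp add: poly_altdef sum_distrib_right exp_minus divide_inverse mult.assoc)
qed

text \<open>With s = 1 / t, differentiating P(s) exp(-s) in t gives s^2 (P - P')(s) exp(-s), which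
  explains the new polynomial. At 0 the one-sided difference quotients are treated
  separately.\<close>

lemma flat_fun_has_derivative:
  "(flat_fun P has_real_derivative flat_fun ([:0, 0, 1:] * (P - pderiv P)) t) (at t)"
proof -
  consider "t > 0" | "t < 0" | "t = 0" by linarith
  then show ?thesis
  proof cases
    case 1
    have "((\<lambda>t. poly P (1 / t) * exp (- 1 / t)) has_real_derivative
        flat_fun ([:0, 0, 1:] * (P - pderiv P)) t) (at t)"
      using 1 by - (rule derivative_eq_intros DERIV_chain2[OF poly_DERIV] refl
          | simp add: flat_fun_def field_simps power2_eq_square)+
    then show ?thesis
      by (rule has_field_derivative_transform_within_open[of _ _ _ "{0<..}"])
        (use 1 in \<open>auto simp: flat_fun_def\<close>)
  next
    case 2
    have "((\<lambda>t. 0) has_real_derivative flat_fun ([:0, 0, 1:] * (P - pderiv P)) t) (at t)"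
      using 2 by (simp add: flat_fun_def)
    then show ?thesis
      by (rule has_field_derivative_transform_within_open[of _ _ _ "{..<0}"])
        (use 2 in \<open>auto simp: flat_fun_def\<close>)
  next
    case 3
    have right: "((\<lambda>h. (flat_fun P h - flat_fun P 0) / (h - 0)) \<longlongrightarrow> 0) (at_right 0)"
    proof (rule Lim_transform_eventually)
      \<comment> \<open>Division by \<open>h\<close> is multiplication by \<open>inverse h\<close>,
        absorbed into the polynomial by the factor \<open>[:0, 1:]\<close>.\<close>
      show "((\<lambda>h. poly ([:0, 1:] * P) (inverse h) * exp (- inverse h)) \<longlongrightarrow> 0) (at_right (0::real))"
        by (rule filterlim_compose[OF poly_exp_minus_tendsto_0 filterlim_inverse_at_top_right])
      show "\<forall>\<^sub>F h in at_right 0. poly ([:0, 1:] * P) (inverse h) * exp (- inverse h) =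
          (flat_fun P h - flat_fun P 0) / (h - 0)"
        unfolding eventually_at_right_field
        by (intro exI[of _ 1]) (auto simp: flat_fun_def field_simps)
    qed
    have left: "((\<lambda>h. (flat_fun P h - flat_fun P 0) / (h - 0)) \<longlongrightarrow> 0) (at_left 0)"
      by (rule Lim_transform_eventually[OF tendsto_const])
        (auto simp: eventually_at_left_field flat_fun_def intro!: exI[of _ "-1"])
    show ?thesis
      unfolding 3 has_field_derivative_iff
      using filterlim_split_at[OF left right] by (simp add: flat_fun_def)
  qed
qed

lemma C_diff_flat_fun: "C_diff k UNIV (flat_fun P)"
proof (induction k arbitrary: P)
  case 0
  show ?case
    unfolding C_diff.simps
    by (intro continuous_at_imp_continuous_on ballI DERIV_isCont[OF flat_fun_has_derivative])
next
  case (Suc k)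
  show ?case
  proof (rule C_diff_SucI)
    show "(flat_fun P has_derivative (\<lambda>v. flat_fun ([:0, 0, 1:] * (P - pderiv P)) x * v)) (at x)" for x
      using flat_fun_has_derivative[of P x] by (simp add: has_field_derivative_def)
    show "C_diff k UNIV (\<lambda>x. flat_fun ([:0, 0, 1:] * (P - pderiv P)) x * v)" for v
      by (rule C_diff_bounded_linear[OF _ bounded_linear_mult_left Suc.IH]) auto
  qed auto
qed

lemma euclidean_bump:
  fixes a :: "'a::euclidean_space"
  assumes "r > 0"
  obtains \<beta> :: "'a \<Rightarrow> real" where "smooth_on UNIV \<beta>" "\<beta> a = 1" "\<And>x. x \<notin> cball a r \<Longrightarrow> \<beta> x = 0"
proof
  \<comment> \<open>\<open>flat_fun 1\<close> is exp(-1/t) for positive t and 0 otherwise, so this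
    vanishes once the distance to \<open>a\<close> reaches \<open>r\<close>; the denominator
    normalizes the value at \<open>a\<close>. Differences are written as sums with negatives to
    match the closure rules.\<close>
  define \<beta> where "\<beta> x = flat_fun 1 (r\<^sup>2 + (- ((x + - a) \<bullet> (x + - a)))) / flat_fun 1 (r\<^sup>2)" for x
  have "C_diff k UNIV (\<lambda>x. x + - a)" for k
    by (intro C_diff_add C_diff_ident C_diff_const open_UNIV)
  then have "C_diff k UNIV (\<lambda>x. - ((x + - a) \<bullet> (x + - a)))" for k
    by (intro C_diff_bounded_linear[OF _ bounded_linear_minus[OF bounded_linear_ident]]
        C_diff_bilinear[OF _ bounded_bilinear_inner] open_UNIV)
  then have "C_diff k UNIV (\<lambda>x. r\<^sup>2 + - ((x + - a) \<bullet> (x + - a)))" for k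
    by (intro C_diff_add C_diff_const open_UNIV)
  then have "C_diff k UNIV (\<lambda>x. flat_fun 1 (r\<^sup>2 + - ((x + - a) \<bullet> (x + - a))))" for k
    by (intro C_diff_compose[OF _ _ _ _ C_diff_flat_fun]) auto
  then show "smooth_on UNIV \<beta>"
    unfolding smooth_on_def \<beta>_def
    by (intro allI C_diff_bounded_linear[OF _ bounded_linear_divide] open_UNIV)
  show "\<beta> a = 1" using assms by (simp add: \<beta>_def flat_fun_def)
  show "\<beta> x = 0" if "x \<notin> cball a r" for x
  proof -
    have "r\<^sup>2 \<le> (norm (x - a))\<^sup>2"
      using that assms by (intro power_mono) (auto simp: dist_norm norm_minus_commute)
    then show ?thesis by (simp add: \<beta>_def flat_fun_def power2_norm_eq_inner)
  qed
qed


section \<open>Fields on manifolds\<close>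

lemma param_snd: "smooth_atlas A \<Longrightarrow> c \<in> A \<Longrightarrow> p \<in> fst c \<Longrightarrow> param c (snd c p) = p"
  unfolding smooth_atlas_def homeomorphism_def by blast

lemma chart_at_mem:
  assumes "smooth_atlas A"
  shows "chart_at A p \<in> A" "p \<in> fst (chart_at A p)"
proof -
  have "\<exists>c. c \<in> A \<and> p \<in> fst c"
    using assms by (metis UN_E UNIV_I smooth_atlas_def)
  from someI_ex[OF this] show "chart_at A p \<in> A" "p \<in> fst (chart_at A p)"
    by (simp_all add: chart_at_def)
qed

lemma open_chart_domain: "smooth_atlas A \<Longrightarrow> c \<in> A \<Longrightarrow> open (fst c)"
  by (simp add: smooth_atlas_def)

text \<open>The image is the preimage of \<open>W\<close> under the continuous map
  \<open>param c\<close> on the open image of the chart.\<close>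

lemma open_chart_image:
  assumes "smooth_atlas A" "c \<in> A" "open W"
  shows "open (snd c ` (fst c \<inter> W))"
proof -
  have h: "homeomorphism (fst c) (snd c ` fst c) (snd c) (param c)" and o: "open (snd c ` fst c)"
    using assms by (auto simp: smooth_atlas_def)
  have "open (snd c ` fst c \<inter> param c -` W)"
    using h o assms(3) by (intro continuous_open_preimage) (auto simp: homeomorphism_def)
  also have "snd c ` fst c \<inter> param c -` W = snd c ` (fst c \<inter> W)"
    using h by (auto simp: homeomorphism_def)
  finally show ?thesis .
qed

text \<open>The Jacobian of the change of coordinates from \<open>c\<close> to \<open>d\<close>.
  Taking the reference chart as source gives \<open>to_chart\<close>; taking it as target gives
  \<open>from_chart\<close>.\<close>

definition transition ::
  "('p, 'e::euclidean_space) chart \<Rightarrow> ('p, 'e) chart \<Rightarrow> 'p \<Rightarrow> 'e \<Rightarrow> 'e" where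
  "transition c d p = frechet_derivative (snd d \<circ> param c) (at (snd c p))"

lemma to_chart_eq: "to_chart A d p = transition (chart_at A p) d p"
  by (auto simp: to_chart_def transition_def Let_def)

lemma transition_has_derivative:
  assumes "smooth_atlas A" "c \<in> A" "d \<in> A" "p \<in> fst c" "p \<in> fst d"
  shows "((snd d \<circ> param c) has_derivative transition c d p) (at (snd c p))"
  unfolding transition_def frechet_derivative_works[symmetric]
  by (rule smooth_on_differentiable[of "snd c ` (fst c \<inter> fst d)"])
    (use assms in \<open>auto simp: smooth_atlas_def\<close>)

lemma linear_transition:
  assumes "smooth_atlas A" "c \<in> A" "d \<in> A" "p \<in> fst c" "p \<in> fst d"
  shows "linear (transition c d p)"
  using transition_has_derivative[OF assms] has_derivative_linear by blast

text \<open>The cocycle law of Jacobians: the chain rule applies because the composed coordinate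
  change equals the direct one on an open set around the point.\<close>

lemma transition_transition:
  assumes A: "smooth_atlas A" "b \<in> A" "c \<in> A" "d \<in> A" and p: "p \<in> fst b" "p \<in> fst c" "p \<in> fst d"
  shows "transition c d p (transition b c p v) = transition b d p v"
proof -
  have "((snd d \<circ> param c) has_derivative transition c d p) (at ((snd c \<circ> param b) (snd b p)))"
    using transition_has_derivative[OF A(1,3,4) p(2,3)] by (simp add: param_snd[OF A(1,2) p(1)])
  from diff_chain_at[OF transition_has_derivative[OF A(1,2,3) p(1,2)] this]
  have "((snd d \<circ> param b) has_derivative transition c d p \<circ> transition b c p) (at (snd b p))"
  proof (rule has_derivative_transform_within_open[OF _ open_chart_image[OF A(1,2) open_chart_domain[OF A(1,3)]]])
    show "(snd d \<circ> param c \<circ> (snd c \<circ> param b)) x = (snd d \<circ> param b) x"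
      if "x \<in> snd b ` (fst b \<inter> fst c)" for x
      using that by (auto simp: param_snd[OF A(1,2)] param_snd[OF A(1,3)])
  qed (use p in auto)
  from has_derivative_unique[OF this transition_has_derivative[OF A(1,2,4) p(1,3)]]
  show ?thesis by (metis comp_apply)
qed

lemma transition_self:
  assumes A: "smooth_atlas A" "c \<in> A" and p: "p \<in> fst c"
  shows "transition c c p v = v"
proof -
  have "((\<lambda>x. x) has_derivative transition c c p) (at (snd c p))"
  proof (rule has_derivative_transform_within_open[OF transition_has_derivative[OF A A(2) p p]
        open_chart_image[OF A open_UNIV]])
    show "(snd c \<circ> param c) x = x" if "x \<in> snd c ` (fst c \<inter> UNIV)" for x
      using that by (auto simp: param_snd[OF A])
  qed (use p in auto)
  from has_derivative_unique[OF this has_derivative_ident] show ?thesis by simp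
qed

lemma linear_to_chart: "smooth_atlas A \<Longrightarrow> d \<in> A \<Longrightarrow> p \<in> fst d \<Longrightarrow> linear (to_chart A d p)"
  unfolding to_chart_eq by (rule linear_transition) (auto intro: chart_at_mem)

text \<open>The inverse of \<open>to_chart\<close> over the domain of \<open>d\<close>. For fixed
  \<open>v\<close> it yields the coordinate field of \<open>d\<close> with constant components
  \<open>v\<close>.\<close>

definition from_chart ::
  "('p, 'e::euclidean_space) chart set \<Rightarrow> ('p, 'e) chart \<Rightarrow> 'p \<Rightarrow> 'e \<Rightarrow> 'e" where
  "from_chart A d p = transition d (chart_at A p) p"

lemma linear_from_chart: "smooth_atlas A \<Longrightarrow> d \<in> A \<Longrightarrow> p \<in> fst d \<Longrightarrow> linear (from_chart A d p)"
  unfolding from_chart_def by (rule linear_transition) (auto intro: chart_at_mem)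

lemma to_chart_from_chart:
  "smooth_atlas A \<Longrightarrow> c \<in> A \<Longrightarrow> d \<in> A \<Longrightarrow> p \<in> fst c \<Longrightarrow> p \<in> fst d \<Longrightarrow>
    to_chart A d p (from_chart A c p v) = transition c d p v"
  unfolding to_chart_eq from_chart_def by (rule transition_transition) (auto intro: chart_at_mem)

lemma from_chart_to_chart:
  assumes "smooth_atlas A" "d \<in> A" "p \<in> fst d"
  shows "from_chart A d p (to_chart A d p v) = v"
proof -
  note m = chart_at_mem[OF assms(1)]
  have "from_chart A d p (to_chart A d p v) = transition (chart_at A p) (chart_at A p) p v"
    unfolding to_chart_eq from_chart_def by (rule transition_transition) (use assms m in auto)
  then show ?thesis by (simp add: transition_self[OF assms(1) m])
qed

section \<open>Smooth functions and sections along a smooth map\<close>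

lemma smooth_fun_local:
  assumes "smooth_atlas A"
    and "\<And>x. \<exists>U. open U \<and> x \<in> U \<and> (\<forall>c\<in>A. smooth_on (snd c ` (fst c \<inter> U)) (f \<circ> param c))"
  shows "smooth_fun A f"
  unfolding smooth_fun_def
proof (intro ballI smooth_on_local)
  fix c y
  assume c: "c \<in> A" and "y \<in> snd c ` fst c"
  then obtain x where x: "x \<in> fst c" "y = snd c x" by auto
  obtain U where "open U" "x \<in> U" "smooth_on (snd c ` (fst c \<inter> U)) (f \<circ> param c)"
    using assms(2)[of x] c by blast
  then show "\<exists>U. open U \<and> y \<in> U \<and> smooth_on U (f \<circ> param c)"
    using x c open_chart_image[OF assms(1)] by blast
qed

text \<open>Used with the immersion for sections over the submanifold, and with the identity for
  vector fields on a single manifold.\<close>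

locale smooth_mapping =
  fixes A :: "('m::{t2_space, second_countable_topology}, 'f::euclidean_space) chart set"
    and B :: "('p::{t2_space, second_countable_topology}, 'e::euclidean_space) chart set"
    and i :: "'m \<Rightarrow> 'p"
  assumes atlasA: "smooth_atlas A" and atlasB: "smooth_atlas B" and map: "smooth_map A B i"
begin

lemma open_vimage_map: "open V \<Longrightarrow> open (i -` V)"
  using map open_vimage by (auto simp: smooth_map_def)

lemma open_domain:
  "c \<in> A \<Longrightarrow> d \<in> B \<Longrightarrow> open W \<Longrightarrow> open (snd c ` (fst c \<inter> W \<inter> i -` fst d))"
  unfolding Int_assoc
  by (intro open_chart_image[OF atlasA] open_Int open_vimage_map open_chart_domain[OF atlasB])

text \<open>The local form of restriction along \<open>i\<close>: a function given in coordinates of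
  the target is composed with the coordinate expression of \<open>i\<close>.\<close>

lemma smooth_on_pullback:
  assumes "c \<in> A" "d \<in> B" "open V" "smooth_on (snd d ` (fst d \<inter> V)) G"
  shows "smooth_on (snd c ` (fst c \<inter> i -` (fst d \<inter> V))) (\<lambda>y. G (snd d (i (param c y))))"
proof (rule smooth_on_compose)
  have "smooth_on (snd c ` (fst c \<inter> i -` fst d)) (snd d \<circ> i \<circ> param c)"
    using map assms(1,2) by (auto simp: smooth_map_def)
  then show "smooth_on (snd c ` (fst c \<inter> i -` (fst d \<inter> V))) (\<lambda>y. snd d (i (param c y)))"
    unfolding o_def by (rule smooth_on_subset) auto
  show "open (snd c ` (fst c \<inter> i -` (fst d \<inter> V)))"
    by (intro open_chart_image[OF atlasA] open_vimage_map open_Int open_chart_domain[OF atlasB] assms)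
  show "open (snd d ` (fst d \<inter> V))"
    by (intro open_chart_image[OF atlasB] assms)
qed (use assms in \<open>auto simp: param_snd[OF atlasA]\<close>)

lemma smooth_fun_pullback:
  assumes "smooth_fun B \<rho>"
  shows "smooth_fun A (\<rho> \<circ> i)"
proof (rule smooth_fun_local[OF atlasA])
  fix x
  define d where "d = chart_at B (i x)"
  have d: "d \<in> B" "i x \<in> fst d" using chart_at_mem[OF atlasB] by (auto simp: d_def)
  have "smooth_on (snd c ` (fst c \<inter> i -` fst d)) (\<rho> \<circ> i \<circ> param c)" if c: "c \<in> A" for c
  proof (rule smooth_on_cong)
    have "smooth_on (snd d ` (fst d \<inter> UNIV)) (\<rho> \<circ> param d)"
      using assms d by (auto simp: smooth_fun_def)
    from smooth_on_pullback[OF c d(1) open_UNIV this]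
    show "smooth_on (snd c ` (fst c \<inter> i -` fst d)) (\<lambda>y. (\<rho> \<circ> param d) (snd d (i (param c y))))"
      by simp
    show "open (snd c ` (fst c \<inter> i -` fst d))" using open_domain[OF c d(1) open_UNIV] by simp
  qed (auto simp: param_snd[OF atlasA c] param_snd[OF atlasB d(1)])
  then show "\<exists>U. open U \<and> x \<in> U \<and> (\<forall>c\<in>A. smooth_on (snd c ` (fst c \<inter> U)) (\<rho> \<circ> i \<circ> param c))"
    using d open_vimage_map[OF open_chart_domain[OF atlasB d(1)]] by blast
qed

lemma smooth_along_Un:
  assumes "open V" "open W" "smooth_along A B i V Y" "smooth_along A B i W Y"
  shows "smooth_along A B i (V \<union> W) Y"
  unfolding smooth_along_def
proof (intro ballI)
  fix c d
  assume cd: "c \<in> A" "d \<in> B"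
  have "smooth_on (snd c ` (fst c \<inter> V \<inter> i -` fst d) \<union> snd c ` (fst c \<inter> W \<inter> i -` fst d))
      ((\<lambda>x. to_chart B d (i x) (Y x)) \<circ> param c)"
    using assms(3,4) cd
    by (intro smooth_on_Un open_domain[OF cd] assms(1,2)) (auto simp: smooth_along_def)
  moreover have "snd c ` (fst c \<inter> V \<inter> i -` fst d) \<union> snd c ` (fst c \<inter> W \<inter> i -` fst d) =
      snd c ` (fst c \<inter> (V \<union> W) \<inter> i -` fst d)" by blast
  ultimately show "smooth_on (snd c ` (fst c \<inter> (V \<union> W) \<inter> i -` fst d))
      ((\<lambda>x. to_chart B d (i x) (Y x)) \<circ> param c)" by simp
qed

text \<open>A formula \<open>F c d\<close> for the components in coordinates need only be right at
  points of the chart; this turns each rule for \<open>smooth_on\<close> into one for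
  sections.\<close>

lemma smooth_alongI:
  assumes "open W"
    and "\<And>c d. c \<in> A \<Longrightarrow> d \<in> B \<Longrightarrow> smooth_on (snd c ` (fst c \<inter> W \<inter> i -` fst d)) (F c d)"
    and "\<And>c d x. c \<in> A \<Longrightarrow> d \<in> B \<Longrightarrow> x \<in> fst c \<Longrightarrow> x \<in> W \<Longrightarrow> i x \<in> fst d \<Longrightarrow>
      F c d (snd c x) = to_chart B d (i x) (Y x)"
  shows "smooth_along A B i W Y"
  unfolding smooth_along_def
proof (intro ballI)
  fix c d
  assume cd: "c \<in> A" "d \<in> B"
  show "smooth_on (snd c ` (fst c \<inter> W \<inter> i -` fst d)) ((\<lambda>x. to_chart B d (i x) (Y x)) \<circ> param c)"
  proof (rule smooth_on_cong[OF open_domain[OF cd assms(1)] _ assms(2)[OF cd]])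
    fix y
    assume "y \<in> snd c ` (fst c \<inter> W \<inter> i -` fst d)"
    then obtain x where "x \<in> fst c" "x \<in> W" "i x \<in> fst d" "y = snd c x" by blast
    then show "F c d y = ((\<lambda>x. to_chart B d (i x) (Y x)) \<circ> param c) y"
      using assms(3)[OF cd] by (simp add: param_snd[OF atlasA cd(1)])
  qed
qed

lemma smooth_alongD:
  "smooth_along A B i W Y \<Longrightarrow> c \<in> A \<Longrightarrow> d \<in> B \<Longrightarrow>
    smooth_on (snd c ` (fst c \<inter> W \<inter> i -` fst d)) (\<lambda>y. to_chart B d (i (param c y)) (Y (param c y)))"
  by (simp add: smooth_along_def o_def)

lemma smooth_along_cong:
  assumes "open W" "\<And>x. x \<in> W \<Longrightarrow> Y x = Y' x" "smooth_along A B i W Y"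
  shows "smooth_along A B i W Y'"
  by (rule smooth_alongI[OF assms(1) smooth_alongD[OF assms(3)]])
    (simp_all add: param_snd[OF atlasA] assms(2))

lemma smooth_along_zero:
  assumes "open W"
  shows "smooth_along A B i W (\<lambda>x. 0)"
  by (rule smooth_alongI[OF assms smooth_on_const[OF open_domain[OF _ _ assms]]])
    (simp_all add: linear_0[OF linear_to_chart[OF atlasB]])

lemma smooth_along_add:
  assumes "open W" "smooth_along A B i W Y" "smooth_along A B i W Y'"
  shows "smooth_along A B i W (\<lambda>x. Y x + Y' x)"
  by (rule smooth_alongI[OF assms(1) smooth_on_add[OF open_domain[OF _ _ assms(1)]
        smooth_alongD[OF assms(2)] smooth_alongD[OF assms(3)]]])
    (simp_all add: param_snd[OF atlasA] linear_add[OF linear_to_chart[OF atlasB]])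

lemma smooth_along_scaleR:
  assumes "open W" "smooth_fun A f" "smooth_along A B i W Y"
  shows "smooth_along A B i W (\<lambda>x. f x *\<^sub>R Y x)"
proof (rule smooth_alongI[OF assms(1) smooth_on_scaleR[OF open_domain[OF _ _ assms(1)]
        _ smooth_alongD[OF assms(3)]]])
  fix c d
  assume "c \<in> A" "d \<in> B"
  then have "smooth_on (snd c ` fst c) (\<lambda>y. f (param c y))"
    using assms(2) by (simp add: smooth_fun_def o_def)
  then show "smooth_on (snd c ` (fst c \<inter> W \<inter> i -` fst d)) (\<lambda>y. f (param c y))"
    by (rule smooth_on_subset) auto
qed (simp_all add: param_snd[OF atlasA] linear_cmul[OF linear_to_chart[OF atlasB]])

lemma smooth_along_const_scaleR:
  assumes "open W" "smooth_along A B i W Y"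
  shows "smooth_along A B i W (\<lambda>x. a *\<^sub>R Y x)"
proof (rule smooth_along_scaleR[OF assms(1) _ assms(2)])
  show "smooth_fun A (\<lambda>x. a)"
    using atlasA by (auto simp: smooth_fun_def o_def smooth_atlas_def intro!: smooth_on_const)
qed

text \<open>The open sets \<open>W\<close> and \<open>- K\<close> cover everything. On the first the
  product is smooth by the product rule, on the second it is zero, so values of \<open>Y\<close>
  outside \<open>W\<close> do not matter.\<close>

lemma smooth_along_cutoff:
  assumes "smooth_fun A \<rho>" "closed K" "K \<subseteq> W" "\<And>x. x \<notin> K \<Longrightarrow> \<rho> x = 0"
    and "open W" "smooth_along A B i W Y"
  shows "smooth_along A B i UNIV (\<lambda>x. \<rho> x *\<^sub>R Y x)"
proof -
  have "smooth_along A B i (W \<union> - K) (\<lambda>x. \<rho> x *\<^sub>R Y x)"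
  proof (rule smooth_along_Un)
    show "smooth_along A B i W (\<lambda>x. \<rho> x *\<^sub>R Y x)"
      by (rule smooth_along_scaleR) (use assms in auto)
    show "smooth_along A B i (- K) (\<lambda>x. \<rho> x *\<^sub>R Y x)"
      by (rule smooth_along_cong[OF _ _ smooth_along_zero]) (use assms in auto)
  qed (use assms in auto)
  moreover have "W \<union> - K = UNIV" using assms(3) by blast
  ultimately show ?thesis by simp
qed

lemma smooth_along_restrict:
  assumes "V \<in> vector_fields B"
  shows "smooth_along A B i UNIV (\<lambda>x. V (i x))"
proof (rule smooth_alongI[OF open_UNIV])
  fix c d
  assume cd: "c \<in> A" "d \<in> B"
  have "smooth_on (snd d ` (fst d \<inter> UNIV)) (\<lambda>y. to_chart B d (param d y) (V (param d y)))"
    using assms cd by (force simp: vector_fields_def smooth_along_def o_def)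
  from smooth_on_pullback[OF cd open_UNIV this]
  show "smooth_on (snd c ` (fst c \<inter> UNIV \<inter> i -` fst d)) (\<lambda>y. to_chart B d
      (param d (snd d (i (param c y)))) (V (param d (snd d (i (param c y))))))" by simp
qed (simp add: param_snd[OF atlasA] param_snd[OF atlasB])

text \<open>Components in \<open>d\<close> are meaningful only over the domain of \<open>d\<close>;
  the factor \<open>\<rho>\<close> turns them into a globally smooth function on the source.\<close>

lemma smooth_fun_coordinate:
  assumes "smooth_fun B \<rho>" "closed K" "K \<subseteq> fst d" "\<And>p. p \<notin> K \<Longrightarrow> \<rho> p = 0"
    and d: "d \<in> B" and Y: "smooth_along A B i UNIV Y"
  shows "smooth_fun A (\<lambda>x. \<rho> (i x) * (to_chart B d (i x) (Y x) \<bullet> b))" (is "smooth_fun A ?f")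
proof (rule smooth_fun_local[OF atlasA])
  fix x
  have rho: "smooth_fun A (\<rho> \<circ> i)" by (rule smooth_fun_pullback[OF assms(1)])
  show "\<exists>U. open U \<and> x \<in> U \<and> (\<forall>c\<in>A. smooth_on (snd c ` (fst c \<inter> U)) (?f \<circ> param c))"
  proof (cases "i x \<in> fst d")
    case True
    have "smooth_on (snd c ` (fst c \<inter> i -` fst d)) (?f \<circ> param c)" if c: "c \<in> A" for c
    proof -
      have op: "open (snd c ` (fst c \<inter> i -` fst d))" using open_domain[OF c d open_UNIV] by simp
      have 1: "smooth_on (snd c ` (fst c \<inter> i -` fst d)) (\<rho> \<circ> i \<circ> param c)"
        by (rule smooth_on_subset[of "snd c ` fst c"]) (use rho c in \<open>auto simp: smooth_fun_def\<close>)
      have "smooth_on (snd c ` (fst c \<inter> i -` fst d)) (\<lambda>y. to_chart B d (i (param c y)) (Y (param c y)))"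
        using smooth_alongD[OF Y c d] by simp
      from smooth_on_scaleR[OF op 1 smooth_on_bounded_linear[OF op bounded_linear_inner_left this, of b]]
      show ?thesis by (simp add: o_def)
    qed
    then show ?thesis
      using True open_vimage_map[OF open_chart_domain[OF atlasB d]] by (intro exI[of _ "i -` fst d"]) auto
  next
    case False
    have "smooth_on (snd c ` (fst c \<inter> i -` (- K))) (?f \<circ> param c)" if c: "c \<in> A" for c
    proof (rule smooth_on_cong)
      show op: "open (snd c ` (fst c \<inter> i -` (- K)))"
        using assms(2) by (intro open_chart_image[OF atlasA c] open_vimage_map) auto
      show "smooth_on (snd c ` (fst c \<inter> i -` (- K))) (\<lambda>y. 0 :: real)" by (rule smooth_on_const[OF op])
    qed (use assms(4) in \<open>auto simp: param_snd[OF atlasA c]\<close>)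
    then show ?thesis
      using False assms(2,3) open_vimage_map[of "- K"] by (intro exI[of _ "i -` (- K)"]) auto
  qed
qed

end

section \<open>Global cutoff functions and frame fields\<close>

lemma smooth_mapping_id:
  assumes "smooth_atlas A"
  shows "smooth_mapping A A id"
  using assms by (auto simp: smooth_mapping_def smooth_map_def smooth_atlas_def)

text \<open>A Euclidean bump is transported by a chart and extended by zero. Its support lies in the
  image \<open>K\<close> of a compact ball, which is closed because the manifold is Hausdorff; hence
  the extension is smooth across the boundary of the chart domain.\<close>

lemma manifold_bump:
  fixes A :: "('p::{t2_space, second_countable_topology}, 'e::euclidean_space) chart set"
  assumes A: "smooth_atlas A" and U: "open U" "x \<in> U"
  obtains \<rho> K where "smooth_fun A \<rho>" "\<rho> x = 1" "closed K" "K \<subseteq> U" "\<And>y. y \<notin> K \<Longrightarrow> \<rho> y = 0"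
proof -
  define c where "c = chart_at A x"
  have c: "c \<in> A" "x \<in> fst c" using chart_at_mem[OF A] by (auto simp: c_def)
  have "snd c x \<in> snd c ` (fst c \<inter> U)" using c U by auto
  then obtain r where r: "r > 0" "cball (snd c x) r \<subseteq> snd c ` (fst c \<inter> U)"
    using open_chart_image[OF A c(1) U(1)] open_contains_cball by blast
  obtain \<beta> :: "'e \<Rightarrow> real" where \<beta>: "smooth_on UNIV \<beta>" "\<beta> (snd c x) = 1"
      "\<And>y. y \<notin> cball (snd c x) r \<Longrightarrow> \<beta> y = 0"
    using euclidean_bump[OF r(1)] by blast
  define K where "K = param c ` cball (snd c x) r"
  define \<rho> where "\<rho> y = (if y \<in> fst c then \<beta> (snd c y) else 0)" for y
  have "continuous_on (cball (snd c x) r) (param c)"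
  proof (rule continuous_on_subset)
    show "continuous_on (snd c ` fst c) (param c)"
      using A c by (auto simp: smooth_atlas_def homeomorphism_def)
  qed (use r in auto)
  then have K: "closed K"
    unfolding K_def by (intro compact_imp_closed compact_continuous_image) auto
  have KU: "K \<subseteq> fst c \<inter> U" using r(2) by (force simp: K_def param_snd[OF A c(1)])
  have supp: "\<rho> y = 0" if "y \<notin> K" for y
  proof (cases "y \<in> fst c")
    case True
    then have "snd c y \<notin> cball (snd c x) r"
      using that param_snd[OF A c(1), of y] by (metis K_def imageI)
    then show ?thesis using \<beta>(3) by (simp add: \<rho>_def)
  qed (simp add: \<rho>_def)
  have "smooth_fun A \<rho>"
  proof (rule smooth_fun_local[OF A])
    fix y
    have "smooth_on (snd d ` (fst d \<inter> - K)) (\<rho> \<circ> param d)" if d: "d \<in> A" for d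
    proof (rule smooth_on_cong)
      show op: "open (snd d ` (fst d \<inter> - K))" using K by (intro open_chart_image[OF A d]) auto
      show "smooth_on (snd d ` (fst d \<inter> - K)) (\<lambda>y. 0 :: real)" by (rule smooth_on_const[OF op])
    qed (use supp in \<open>auto simp: param_snd[OF A d]\<close>)
    moreover have "smooth_on (snd d ` (fst d \<inter> fst c)) (\<rho> \<circ> param d)" if d: "d \<in> A" for d
    proof (rule smooth_on_cong)
      show op: "open (snd d ` (fst d \<inter> fst c))"
        by (intro open_chart_image[OF A d] open_chart_domain[OF A c(1)])
      have "smooth_on (snd d ` (fst d \<inter> fst c)) (snd c \<circ> param d)"
        using A c d by (simp add: smooth_atlas_def)
      then show "smooth_on (snd d ` (fst d \<inter> fst c)) (\<lambda>y. \<beta> ((snd c \<circ> param d) y))"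
        by (rule smooth_on_compose[OF op open_UNIV subset_UNIV _ \<beta>(1)])
    qed (auto simp: \<rho>_def param_snd[OF A d])
    ultimately show "\<exists>U. open U \<and> y \<in> U \<and> (\<forall>c\<in>A. smooth_on (snd c ` (fst c \<inter> U)) (\<rho> \<circ> param c))"
      using K KU open_chart_domain[OF A c(1)] by (cases "y \<in> K") (blast, metis ComplI open_Compl)
  qed
  then show thesis
    using that[of \<rho> K] K KU supp c \<beta>(2) by (auto simp: \<rho>_def)
qed

text \<open>In any fixed chart \<open>e\<close> the components of a coordinate field of
  \<open>d\<close> are the derivative of the coordinate change in the fixed direction
  \<open>b\<close>, hence smooth. Cutting off makes the field global.\<close>

lemma frame_field:
  fixes A :: "('p::{t2_space, second_countable_topology}, 'e::euclidean_space) chart set"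
  assumes A: "smooth_atlas A" and d: "d \<in> A"
    and \<rho>: "smooth_fun A \<rho>" "closed K" "K \<subseteq> fst d" "\<And>p. p \<notin> K \<Longrightarrow> \<rho> p = 0"
  shows "(\<lambda>p. \<rho> p *\<^sub>R from_chart A d p b) \<in> vector_fields A"
proof -
  interpret smooth_mapping A A id by (rule smooth_mapping_id[OF A])
  have "smooth_along A A id (fst d) (\<lambda>p. from_chart A d p b)"
  proof (rule smooth_alongI[OF open_chart_domain[OF A d]])
    fix c e
    assume ce: "c \<in> A" "e \<in> A"
    have "smooth_on (snd d ` (fst d \<inter> fst e)) (snd e \<circ> param d)"
      using A d ce by (simp add: smooth_atlas_def)
    from smooth_on_pullback[OF ce(1) d open_chart_domain[OF A ce(2)]
        smooth_on_frechet_derivative[OF this, of b]]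
    show "smooth_on (snd c ` (fst c \<inter> fst d \<inter> id -` fst e))
        (\<lambda>y. frechet_derivative (snd e \<circ> param d) (at (snd d (param c y))) b)"
      by (simp add: Int_assoc)
  qed (simp add: param_snd[OF A] to_chart_from_chart[OF A d] transition_def)
  from smooth_along_cutoff[OF \<rho> open_chart_domain[OF A d] this]
  show ?thesis by (simp add: vector_fields_def)
qed


section \<open>Sections and connections along the immersion\<close>

text \<open>Local spanning sections become global after a cutoff that is 1 at \<open>x\<close>. The
  values at \<open>x\<close> of global sections form a subspace, so they contain the whole span of
  these local sections.\<close>

lemma section_through:
  assumes "smooth_mapping (sub_atlas M) (atlas N) (imm M)" "smooth_bundle N M E k" "v \<in> E x"
  obtains Y where "Y \<in> sections N M E" "Y x = v"
proof -
  interpret smooth_mapping "sub_atlas M" "atlas N" "imm M" by fact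
  have sub: "subspace (E y)" for y using assms(2) by (auto simp: smooth_bundle_def)
  obtain W s where W: "open W" "x \<in> W" and s: "\<And>j. j < k \<Longrightarrow> smooth_over N M W (s j)"
    and E: "\<And>y. y \<in> W \<Longrightarrow> E y = span ((\<lambda>j. s j y) ` {..<k})"
    using assms(2) unfolding smooth_bundle_def by meson
  obtain \<rho> K where \<rho>: "smooth_fun (sub_atlas M) \<rho>" "\<rho> x = 1" "closed K" "K \<subseteq> W"
      "\<And>y. y \<notin> K \<Longrightarrow> \<rho> y = 0"
    using manifold_bump[OF atlasA W] by blast
  have "span ((\<lambda>j. s j x) ` {..<k}) \<subseteq> {Y x | Y. Y \<in> sections N M E}"
  proof (rule span_minimal)
    show "(\<lambda>j. s j x) ` {..<k} \<subseteq> {Y x | Y. Y \<in> sections N M E}"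
    proof (rule image_subsetI)
      fix j
      assume j: "j \<in> {..<k}"
      have "smooth_over N M UNIV (\<lambda>y. \<rho> y *\<^sub>R s j y)"
        unfolding smooth_over_def
        by (rule smooth_along_cutoff[OF \<rho>(1,3-5) W(1)]) (use s j in \<open>auto simp: smooth_over_def\<close>)
      moreover have "\<rho> y *\<^sub>R s j y \<in> E y" for y
      proof (cases "y \<in> W")
        case True
        then show ?thesis using j E by (auto intro: span_mul span_base)
      next
        case False
        then show ?thesis using \<rho>(4,5) sub subspace_0 by fastforce
      qed
      ultimately have "(\<lambda>y. \<rho> y *\<^sub>R s j y) \<in> sections N M E" by (simp add: sections_def)
      then show "s j x \<in> {Y x | Y. Y \<in> sections N M E}"
        using \<rho>(2) by (intro CollectI exI[of _ "\<lambda>y. \<rho> y *\<^sub>R s j y"]) simp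
    qed
    show "subspace {Y x | Y. Y \<in> sections N M E}"
    proof (rule subspaceI)
      have "(\<lambda>y. 0) \<in> sections N M E"
        by (simp add: sections_def smooth_over_def smooth_along_zero subspace_0 sub)
      then show "0 \<in> {Y x | Y. Y \<in> sections N M E}" by force
    next
      fix u w
      assume "u \<in> {Y x | Y. Y \<in> sections N M E}" "w \<in> {Y x | Y. Y \<in> sections N M E}"
      then obtain Y Y' where Y: "Y \<in> sections N M E" "u = Y x" "Y' \<in> sections N M E" "w = Y' x" by auto
      then have "(\<lambda>y. Y y + Y' y) \<in> sections N M E"
        by (simp add: sections_def smooth_over_def smooth_along_add subspace_add sub)
      then show "u + w \<in> {Y x | Y. Y \<in> sections N M E}" using Y by force
    next
      fix a u
      assume "u \<in> {Y x | Y. Y \<in> sections N M E}"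
      then obtain Y where Y: "Y \<in> sections N M E" "u = Y x" by auto
      then have "(\<lambda>y. a *\<^sub>R Y y) \<in> sections N M E"
        by (simp add: sections_def smooth_over_def smooth_along_const_scaleR subspace_scale sub)
      then show "a *\<^sub>R u \<in> {Y x | Y. Y \<in> sections N M E}" using Y by force
    qed
  qed
  then show thesis using that assms(3) E[OF W(2)] by blast
qed

text \<open>Both sides differ by an expression that is linear over functions in \<open>Y\<close>. It vanishes on
  restrictions of ambient fields because \<open>\<nabla>J = 0\<close>, hence on all \<open>Y\<close>: near \<open>x\<close> a section is a
  combination of the frame fields of a chart, and two factors \<open>\<rho> \<circ> imm M\<close> of a cutoff make the
  coefficients and the frame globally defined.\<close>

lemma along_connection_bronze:
  fixes x
  assumes ambient: "locally_bronze N q nab"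
    and conn: "along_connection N M (lm_connection N nab l m \<eta>) C"
    and sm: "smooth_mapping (sub_atlas M) (atlas N) (imm M)"
    and X: "X \<in> sections N M (tangent N M)"
    and Y: "Y \<in> sections N M (\<lambda>_. UNIV)" "(\<lambda>y. bronze_on N M y (Y y)) \<in> sections N M (\<lambda>_. UNIV)"
  defines "K \<equiv> l (imm M x) *\<^sub>R X x + m (imm M x) *\<^sub>R bronze_on N M x (X x)"
  shows "C X (\<lambda>y. bronze_on N M y (Y y)) x + \<theta>_form N \<eta> (imm M x) (Y x) *\<^sub>R bronze_on N M x K =
    bronze_on N M x (C X Y x) + \<theta>_form N \<eta> (imm M x) (bronze_on N M x (Y x)) *\<^sub>R K"
proof -
  interpret smooth_mapping "sub_atlas M" "atlas N" "imm M" by fact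
  interpret idm: smooth_mapping "atlas N" "atlas N" id by (rule smooth_mapping_id[OF atlasB])
  let ?A = "sub_atlas M" and ?B = "atlas N" and ?i = "imm M" and ?\<theta> = "\<theta>_form N \<eta> (imm M x)"
  let ?J = "bronze_on N M" and ?p = "imm M x"
  let ?TN = "sections N M (\<lambda>_. UNIV)"
  have TN: "Z \<in> ?TN \<longleftrightarrow> smooth_along ?A ?B ?i UNIV Z" for Z
    by (simp add: sections_def smooth_over_def)
  have bm: "bronze_manifold N q" using ambient by (simp add: locally_bronze_def)
  have Jlin: "linear (bronze N p)" for p using bm by (simp add: bronze_manifold_def)
  have JonLin: "linear (?J y)" for y unfolding bronze_on_def by (rule Jlin)
  have Jvf: "(\<lambda>p. bronze N p (V p)) \<in> vector_fields ?B" if "V \<in> vector_fields ?B" for V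
    using bm that by (simp add: bronze_manifold_def)
  have parallel: "nab U (\<lambda>p. bronze N p (V p)) p = bronze N p (nab U V p)"
    if "U \<in> vector_fields ?B" "V \<in> vector_fields ?B" for U V p
    using ambient that by (simp add: locally_bronze_def)
  have "bilinear (metric N ?p)"
    using bm by (simp add: bronze_manifold_def semi_riemannian_metric_def)
  then have \<theta>lin: "linear ?\<theta>" by (simp add: bilinear_def \<theta>_form_def[abs_def])
  have C_add: "C X (\<lambda>y. Z y + Z' y) x = C X Z x + C X Z' x" if "Z \<in> ?TN" "Z' \<in> ?TN" for Z Z'
    using conn X that by (simp add: along_connection_def Let_def)
  have C_restrict: "C X (\<lambda>y. V (?i y)) x = lm_connection N nab l m \<eta> U V ?p"
    if "U \<in> vector_fields ?B" "V \<in> vector_fields ?B" "U ?p = X x" for U V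
    using conn X that by (simp add: along_connection_def Let_def)
  obtain v where v: "immersion_at N M x v = X x"
    using X by (auto simp: sections_def tangent_def image_iff) metis
  have C_leibniz: "C X (\<lambda>y. f y *\<^sub>R Z y) x = dir_deriv ?A f x v *\<^sub>R Z x + f x *\<^sub>R C X Z x"
    if "smooth_fun ?A f" "Z \<in> ?TN" for f Z
    using conn X that v by (simp add: along_connection_def Let_def)
  \<comment> \<open>The difference of the two sides of the claim, as a function of the
    differentiated section.\<close>
  define defect where "defect Z = C X (\<lambda>y. ?J y (Z y)) x + ?\<theta> (Z x) *\<^sub>R ?J x K
      - ?J x (C X Z x) - ?\<theta> (?J x (Z x)) *\<^sub>R K" for Z
  \<comment> \<open>The rules for \<open>C\<close> are available on smooth sections only, and
    \<open>defect\<close> applies \<open>C\<close> both to \<open>Z\<close> and to its image under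
    the bronze structure.\<close>
  define good where "good Z \<longleftrightarrow> Z \<in> ?TN \<and> (\<lambda>y. ?J y (Z y)) \<in> ?TN" for Z

  have good_scale: "good (\<lambda>y. f y *\<^sub>R Z y)" if "smooth_fun ?A f" "good Z" for f Z
    using that smooth_along_scaleR[OF open_UNIV that(1)]
    by (simp add: good_def TN linear_cmul[OF JonLin])
  \<comment> \<open>The derivative of \<open>f\<close> enters twice, each time multiplied by the
    image of \<open>Z x\<close> under the bronze structure and with opposite signs, so it
    cancels.\<close>
  have defect_scale: "defect (\<lambda>y. f y *\<^sub>R Z y) = f x *\<^sub>R defect Z" if "smooth_fun ?A f" "good Z" for f Z
  proof -
    have "C X (\<lambda>y. ?J y (f y *\<^sub>R Z y)) x =
        dir_deriv ?A f x v *\<^sub>R ?J x (Z x) + f x *\<^sub>R C X (\<lambda>y. ?J y (Z y)) x"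
      using that C_leibniz[of f "\<lambda>y. ?J y (Z y)"] by (simp add: good_def linear_cmul[OF JonLin])
    moreover have "?J x (C X (\<lambda>y. f y *\<^sub>R Z y) x) =
        dir_deriv ?A f x v *\<^sub>R ?J x (Z x) + f x *\<^sub>R ?J x (C X Z x)"
      using that C_leibniz[of f Z]
      by (simp add: good_def linear_cmul[OF JonLin] linear_add[OF JonLin])
    ultimately show ?thesis
      by (simp add: defect_def linear_cmul[OF JonLin] linear_cmul[OF \<theta>lin] algebra_simps)
  qed
  have good_add: "good (\<lambda>y. Z y + Z' y)" if "good Z" "good Z'" for Z Z'
    using that by (simp add: good_def TN linear_add[OF JonLin] smooth_along_add)
  have defect_add: "defect (\<lambda>y. Z y + Z' y) = defect Z + defect Z'" if "good Z" "good Z'" for Z Z'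
    using that C_add[of Z Z'] C_add[of "\<lambda>y. ?J y (Z y)" "\<lambda>y. ?J y (Z' y)"]
    by (simp add: good_def defect_def linear_add[OF JonLin] linear_add[OF \<theta>lin] algebra_simps)

  define d where "d = chart_at ?B ?p"
  have d: "d \<in> ?B" "?p \<in> fst d" using chart_at_mem[OF atlasB] by (auto simp: d_def)
  obtain \<rho> S where \<rho>: "smooth_fun ?B \<rho>" "\<rho> ?p = 1" "closed S" "S \<subseteq> fst d" "\<And>y. y \<notin> S \<Longrightarrow> \<rho> y = 0"
    using manifold_bump[OF atlasB open_chart_domain[OF atlasB d(1)] d(2)] by blast
  define E where "E b p = \<rho> p *\<^sub>R from_chart ?B d p b" for b p
  have E: "E b \<in> vector_fields ?B" for b
    unfolding E_def by (rule frame_field[OF atlasB d(1) \<rho>(1,3-5)])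

  have restrict: "good (\<lambda>y. V (?i y)) \<and> defect (\<lambda>y. V (?i y)) = 0" if V: "V \<in> vector_fields ?B" for V
  proof
    show "good (\<lambda>y. V (?i y))"
      using smooth_along_restrict[OF V] smooth_along_restrict[OF Jvf[OF V]]
      by (simp add: good_def TN bronze_on_def)
    \<comment> \<open>An ambient extension of the single vector \<open>X x\<close>: the cutoff is 1
      at \<open>?p\<close>. Agreement at this point is all that the restriction clause for
      \<open>C\<close> asks of \<open>U\<close>.\<close>
    define U where "U = E (to_chart ?B d ?p (X x))"
    have U: "U \<in> vector_fields ?B" "U ?p = X x"
      using E \<rho>(2) by (auto simp: U_def E_def from_chart_to_chart[OF atlasB d])
    have "C X (\<lambda>y. V (?i y)) x = nab U V ?p + ?\<theta> (V ?p) *\<^sub>R K"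
      by (simp add: C_restrict[OF U(1) V U(2)] lm_connection_def K_def U(2) bronze_on_def)
    moreover have "C X (\<lambda>y. ?J y (V (?i y))) x = ?J x (nab U V ?p) + ?\<theta> (?J x (V ?p)) *\<^sub>R K"
      using C_restrict[OF U(1) Jvf[OF V] U(2)] parallel[OF U(1) V]
      by (simp add: lm_connection_def K_def U(2) bronze_on_def)
    ultimately show "defect (\<lambda>y. V (?i y)) = 0"
      by (simp add: defect_def linear_add[OF JonLin] linear_cmul[OF JonLin])
  qed

  define f where "f b y = \<rho> (?i y) * (to_chart ?B d (?i y) (Y y) \<bullet> b)" for b y
  have f: "smooth_fun ?A (f b)" for b
    unfolding f_def by (rule smooth_fun_coordinate[OF \<rho>(1,3-5) d(1) iffD1[OF TN Y(1)]])
  have "good (\<lambda>y. \<Sum>b\<in>I. f b y *\<^sub>R E b (?i y)) \<and> defect (\<lambda>y. \<Sum>b\<in>I. f b y *\<^sub>R E b (?i y)) = 0"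
    if "finite I" for I
    using that
  proof induction
    case empty
    have "(\<lambda>p. 0) \<in> vector_fields ?B" by (simp add: vector_fields_def idm.smooth_along_zero)
    from restrict[OF this] show ?case by simp
  next
    case (insert b I)
    have "good (\<lambda>y. f b y *\<^sub>R E b (?i y)) \<and> defect (\<lambda>y. f b y *\<^sub>R E b (?i y)) = 0"
      using restrict[OF E] by (simp add: good_scale[OF f] defect_scale[OF f])
    with insert show ?case
      using good_add[of "\<lambda>y. f b y *\<^sub>R E b (?i y)" "\<lambda>y. \<Sum>b\<in>I. f b y *\<^sub>R E b (?i y)"]
        defect_add[of "\<lambda>y. f b y *\<^sub>R E b (?i y)" "\<lambda>y. \<Sum>b\<in>I. f b y *\<^sub>R E b (?i y)"]
      by simp
  qed
  then have "defect (\<lambda>y. \<Sum>b\<in>Basis. f b y *\<^sub>R E b (?i y)) = 0" by simp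
  also have "(\<lambda>y. \<Sum>b\<in>Basis. f b y *\<^sub>R E b (?i y)) =
      (\<lambda>y. (\<rho> \<circ> ?i) y *\<^sub>R ((\<rho> \<circ> ?i) y *\<^sub>R Y y))"
  proof
    fix y
    show "(\<Sum>b\<in>Basis. f b y *\<^sub>R E b (?i y)) = (\<rho> \<circ> ?i) y *\<^sub>R ((\<rho> \<circ> ?i) y *\<^sub>R Y y)"
    proof (cases "?i y \<in> fst d")
      case True
      let ?w = "to_chart ?B d (?i y) (Y y)"
      note lin = linear_from_chart[OF atlasB d(1) True]
      have "(\<Sum>b\<in>Basis. f b y *\<^sub>R E b (?i y)) =
          \<rho> (?i y) *\<^sub>R \<rho> (?i y) *\<^sub>R (\<Sum>b\<in>Basis. (?w \<bullet> b) *\<^sub>R from_chart ?B d (?i y) b)"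
        by (simp add: f_def E_def scaleR_sum_right mult_ac)
      also have "(\<Sum>b\<in>Basis. (?w \<bullet> b) *\<^sub>R from_chart ?B d (?i y) b) =
          from_chart ?B d (?i y) (\<Sum>b\<in>Basis. (?w \<bullet> b) *\<^sub>R b)"
        by (simp only: linear_sum[OF lin] linear_cmul[OF lin])
      also have "\<dots> = Y y"
        by (simp only: euclidean_representation from_chart_to_chart[OF atlasB d(1) True])
      finally show ?thesis by simp
    next
      case False
      then have "\<rho> (?i y) = 0" using \<rho>(4,5) by blast
      then show ?thesis by (simp add: E_def)
    qed
  qed
  also have "defect \<dots> = (\<rho> \<circ> ?i) x *\<^sub>R (\<rho> \<circ> ?i) x *\<^sub>R defect Y"
  proof -
    have "smooth_fun ?A (\<rho> \<circ> ?i)" by (rule smooth_fun_pullback[OF \<rho>(1)])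
    moreover have "good Y" using Y by (simp add: good_def)
    ultimately show ?thesis by (simp only: defect_scale good_scale)
  qed
  finally have "defect Y = 0" using \<rho>(2) by simp
  then show ?thesis by (simp add: defect_def algebra_simps)
qed


section \<open>The splitting of the ambient tangent space\<close>

lemma dim_orthogonal_complement:
  fixes g :: "'e::euclidean_space \<Rightarrow> 'e \<Rightarrow> real"
  assumes g: "bilinear g" "nondegenerate_on UNIV g" and V: "subspace V"
  shows "dim V + dim {v. \<forall>u\<in>V. g u v = 0} = DIM('e)"
proof -
  define A where "A u = (\<Sum>b\<in>Basis. g u b *\<^sub>R b)" for u
  have lin: "linear (g u)" "linear (\<lambda>u. g u v)" for u v
    using g(1) by (auto simp: bilinear_def)
  have gA: "g u v = A u \<bullet> v" for u v
  proof -
    have "g u v = g u (\<Sum>b\<in>Basis. (v \<bullet> b) *\<^sub>R b)" by (simp add: euclidean_representation)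
    also have "\<dots> = (\<Sum>b\<in>Basis. (v \<bullet> b) * g u b)"
      by (simp only: linear_sum[OF lin(1)] linear_cmul[OF lin(1)] real_scaleR_def)
    also have "\<dots> = A u \<bullet> v"
      unfolding A_def inner_sum_left by (simp add: inner_commute mult.commute)
    finally show ?thesis .
  qed
  have linA: "linear A"
    by (rule linearI; rule euclidean_eqI)
      (simp_all add: A_def linear_add[OF lin(2)] linear_cmul[OF lin(2)] inner_add_left)
  have "inj A"
    unfolding linear_injective_0[OF linA]
    using g(2) by (simp add: nondegenerate_on_def gA)
  then have "dim (A ` V) = dim V"
    using dim_image_eq[OF linA] inj_on_subset by blast
  moreover have "dim {y \<in> UNIV. \<forall>x\<in>A ` V. orthogonal x y} + dim (A ` V) = dim (UNIV :: 'e set)"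
    by (rule dim_subspace_orthogonal_to_vectors) (auto intro: linear_subspace_image linA V)
  ultimately show ?thesis
    by (simp add: gA orthogonal_def)
qed

text \<open>The linear algebra at one point: \<open>T\<close>, \<open>R\<close>, \<open>P\<close>,
  \<open>L\<close> stand for the tangent space, its radical, the screen transversal and the
  lightlike transversal space. By \<open>pairing\<close> and \<open>dimL\<close>, \<open>g\<close>
  pairs \<open>L\<close> and \<open>R\<close> perfectly.\<close>

locale lightlike_splitting =
  fixes g :: "'e::euclidean_space \<Rightarrow> 'e \<Rightarrow> real" and T R P L :: "'e set"
  assumes bil: "bilinear g" and sym: "g u v = g v u" and nondeg: "nondegenerate_on UNIV g"
    and sub: "subspace T" "subspace R" "subspace P" "subspace L"
    and R: "R = T \<inter> {v. \<forall>u\<in>T. g u v = 0}"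
    and N: "orthogonal_sum g {v. \<forall>u\<in>T. g u v = 0} R P"
    and dimL: "dim L = dim R"
    and pairing: "b \<in> L \<Longrightarrow> (\<And>\<xi>. \<xi> \<in> R \<Longrightarrow> g b \<xi> = 0) \<Longrightarrow> b = 0"
    and LP: "b \<in> L \<Longrightarrow> c \<in> P \<Longrightarrow> g b c = 0"
begin

lemma linear_form: "linear (g u)" "linear (\<lambda>u. g u v)"
  using bil by (auto simp: bilinear_def)

lemmas form_simps =
  linear_add[OF linear_form(1)] linear_add[OF linear_form(2)]
  linear_diff[OF linear_form(1)] linear_diff[OF linear_form(2)]
  linear_cmul[OF linear_form(1)] linear_cmul[OF linear_form(2)]
  linear_neg[OF linear_form(1)] linear_neg[OF linear_form(2)]
  linear_0[OF linear_form(1)] linear_0[OF linear_form(2)]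

lemma P_normal: "c \<in> P \<Longrightarrow> u \<in> T \<Longrightarrow> g u c = 0" "c \<in> P \<Longrightarrow> u \<in> T \<Longrightarrow> g c u = 0"
proof -
  assume c: "c \<in> P" "u \<in> T"
  have "0 + c \<in> {v. \<forall>u\<in>T. g u v = 0}"
    using N c(1) subspace_0[OF sub(2)] unfolding orthogonal_sum_def by blast
  then show "g u c = 0" using c by simp
  then show "g c u = 0" by (simp add: sym)
qed

lemma Rad_tangent: "\<xi> \<in> R \<Longrightarrow> \<xi> \<in> T"
  by (simp add: R)

lemma Rad_normal: "\<xi> \<in> R \<Longrightarrow> u \<in> T \<Longrightarrow> g u \<xi> = 0"
  by (simp add: R)

text \<open>Pairing the sum with radical vectors kills the parts in \<open>T\<close> and
  \<open>P\<close>, whence \<open>b = 0\<close>. Then \<open>c\<close> is both tangent and normal,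
  so it lies in \<open>R\<close> and in \<open>P\<close>, which meet in zero.\<close>

lemma splitting_zero:
  assumes "a \<in> T" "b \<in> L" "c \<in> P" "a + b + c = 0"
  shows "a = 0" "b = 0" "c = 0"
proof -
  show b: "b = 0"
  proof (rule pairing[OF assms(2)])
    fix \<xi>
    assume "\<xi> \<in> R"
    moreover have "g (a + b + c) \<xi> = 0" using assms(4) by (simp add: form_simps)
    ultimately show "g b \<xi> = 0"
      using assms(1-3) Rad_normal P_normal Rad_tangent by (simp add: form_simps)
  qed
  have a: "a = - c" using assms(4) b by (simp add: eq_neg_iff_add_eq_0)
  then have cT: "c \<in> T" using subspace_neg[OF sub(1) assms(1)] by simp
  have "c \<in> R" using cT assms(3) P_normal by (auto simp: R)
  then show "c = 0" using N assms(3) unfolding orthogonal_sum_def by blast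
  then show "a = 0" using a by simp
qed

text \<open>A dimension count: dim \<open>L\<close> + dim \<open>P\<close> = dim \<open>R\<close> +
  dim \<open>P\<close> is the dimension of the normal space, which is complementary to dim
  \<open>T\<close>. Since the three summands are independent, their sum is the whole space.\<close>

lemma splitting_exists: "\<exists>a\<in>T. \<exists>b\<in>L. \<exists>c\<in>P. v = a + b + c"
proof -
  let ?N = "{v. \<forall>u\<in>T. g u v = 0}"
  let ?LP = "{b + c | b c. b \<in> L \<and> c \<in> P}"
  let ?V = "{a + w | a w. a \<in> T \<and> w \<in> ?LP}"
  have subLP: "subspace ?LP" by (rule subspace_sums[OF sub(4,3)])
  have "R \<inter> P = {0}" and "?N = {u + v | u v. u \<in> R \<and> v \<in> P}"
    using N unfolding orthogonal_sum_def by blast+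
  then have dimN: "dim ?N = dim R + dim P"
    using dim_sums_Int[OF sub(2,3)] by simp
  have "L \<inter> P \<subseteq> {0}"
  proof
    fix w
    assume "w \<in> L \<inter> P"
    then have "w = 0" using splitting_zero(2)[of 0 w "- w"] sub(1,3) subspace_0 subspace_neg by fastforce
    then show "w \<in> {0}" by simp
  qed
  then have LP0: "dim (L \<inter> P) = 0" by (simp add: dim_eq_0)
  have dimLP: "dim ?LP = dim L + dim P"
    using dim_sums_Int[OF sub(4,3)] LP0 by linarith
  have "T \<inter> ?LP \<subseteq> {0}"
  proof
    fix w
    assume "w \<in> T \<inter> ?LP"
    then obtain b c where w: "w \<in> T" "b \<in> L" "c \<in> P" "w = b + c" by auto
    have "w = 0"
      by (rule splitting_zero(1)[of w "- b" "- c"]) (use w subspace_neg sub in auto)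
    then show "w \<in> {0}" by simp
  qed
  then have "dim (T \<inter> ?LP) = 0" by (simp add: dim_eq_0)
  then have "dim ?V = dim T + dim ?LP"
    using dim_sums_Int[OF sub(1) subLP] by linarith
  then have "dim ?V = DIM('e)"
    using dim_orthogonal_complement[OF bil nondeg sub(1)] dimN dimLP dimL by linarith
  then have "span ?V = UNIV" by (simp add: dim_eq_full)
  moreover have "span ?V = ?V"
    by (rule iffD2[OF span_eq_iff subspace_sums[OF sub(1) subLP]])
  ultimately have "v \<in> ?V" by (metis UNIV_I)
  then obtain a b c where "a \<in> T" "b \<in> L" "c \<in> P" "v = a + (b + c)" by blast
  then show ?thesis by (auto simp: add.assoc)
qed

lemma splitting_unique:
  assumes "a \<in> T" "b \<in> L" "c \<in> P" "a' \<in> T" "b' \<in> L" "c' \<in> P" "a + b + c = a' + b' + c'"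
  shows "a = a'" "b = b'" "c = c'"
proof -
  have "(a - a') + (b - b') + (c - c') = 0" using assms(7) by (simp add: algebra_simps)
  from splitting_zero[OF subspace_diff[OF sub(1) assms(1,4)] subspace_diff[OF sub(4) assms(2,5)]
      subspace_diff[OF sub(3) assms(3,6)] this]
  show "a = a'" "b = b'" "c = c'" by simp_all
qed

lemma components_eq:
  assumes "a \<in> T" "b \<in> L" "c \<in> P"
  shows "component T L P (a + b + c) = a" "component L T P (a + b + c) = b"
    "component P T L (a + b + c) = c"
proof -
  show "component T L P (a + b + c) = a"
    unfolding component_def
    by (rule the_equality) (use assms splitting_unique(1) in blast)+
  show "component L T P (a + b + c) = b"
    unfolding component_def
  proof (rule the_equality)
    show "b \<in> L \<and> (\<exists>a'\<in>T. \<exists>c'\<in>P. a + b + c = b + a' + c')"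
      using assms by (intro conjI bexI[of _ a] bexI[of _ c]) simp_all
    fix b'
    assume "b' \<in> L \<and> (\<exists>a'\<in>T. \<exists>c'\<in>P. a + b + c = b' + a' + c')"
    then obtain a' c' where "b' \<in> L" "a' \<in> T" "c' \<in> P" "a + b + c = a' + b' + c'"
      by (auto simp: add.commute[of b'])
    then show "b' = b" using splitting_unique(2)[OF assms] by simp
  qed
  show "component P T L (a + b + c) = c"
    unfolding component_def
  proof (rule the_equality)
    show "c \<in> P \<and> (\<exists>a'\<in>T. \<exists>b'\<in>L. a + b + c = c + a' + b')"
      using assms by (intro conjI bexI[of _ a] bexI[of _ b]) simp_all
    fix c'
    assume "c' \<in> P \<and> (\<exists>a'\<in>T. \<exists>b'\<in>L. a + b + c = c' + a' + b')"
    then obtain a' b' where *: "c' \<in> P" "a' \<in> T" "b' \<in> L" "a + b + c = c' + a' + b'" by blast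
    then have "a + b + c = a' + b' + c'" by (simp add: add.assoc add.commute[of c'])
    then show "c' = c" using splitting_unique(3)[OF assms] * by simp
  qed
qed

lemma components:
  shows "component T L P v \<in> T" "component L T P v \<in> L" "component P T L v \<in> P"
    and "component T L P v + component L T P v + component P T L v = v"
proof -
  obtain a b c where "a \<in> T" "b \<in> L" "c \<in> P" and v: "v = a + b + c"
    using splitting_exists by blast
  then show "component T L P v \<in> T" "component L T P v \<in> L" "component P T L v \<in> P"
    "component T L P v + component L T P v + component P T L v = v"
    by (simp_all add: v components_eq)
qed

text \<open>Such a \<open>c\<close> is orthogonal to \<open>T\<close> by normality and to
  \<open>L\<close> by \<open>LP\<close>, hence to everything, and the ambient form is
  nondegenerate.\<close>

lemma nondegenerate_P:
  assumes "c \<in> P" "\<And>w. w \<in> P \<Longrightarrow> g c w = 0"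
  shows "c = 0"
proof -
  have "g c v = 0" for v
  proof -
    obtain a b e where v: "a \<in> T" "b \<in> L" "e \<in> P" "v = a + b + e"
      using splitting_exists by blast
    have "g c b = 0" by (subst sym) (rule LP[OF v(2) assms(1)])
    then show ?thesis
      using assms(2)[OF v(3)] P_normal(2)[OF assms(1) v(1)] by (simp add: v(4) form_simps)
  qed
  then show ?thesis using nondeg by (simp add: nondegenerate_on_def)
qed

end


section \<open>Bronze structures and mixed geodesic submanifolds\<close>

locale bronze_splitting = lightlike_splitting g T R P L
  for g :: "'e::euclidean_space \<Rightarrow> 'e \<Rightarrow> real" and T R P L +
  fixes J :: "'e \<Rightarrow> 'e"
  assumes J_linear: "linear J" and J_bronze: "J (J v) = 3 *\<^sub>R J v + v"
    and J_symmetric: "g (J u) v = g u (J v)" and J_Rad: "J ` R = R"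
begin

abbreviation tp where "tp \<equiv> component T L P"
abbreviation lp where "lp \<equiv> component L T P"
abbreviation pp where "pp \<equiv> component P T L"

text \<open>The radical is normal, which removes the part in \<open>T\<close>, and tangent, which
  removes the part in \<open>P\<close>.\<close>

lemma form_Rad:
  assumes "\<xi> \<in> R"
  shows "g v \<xi> = g (lp v) \<xi>"
proof -
  have "g (tp v) \<xi> = 0" "g (pp v) \<xi> = 0"
    by (rule Rad_normal[OF assms components(1)], rule P_normal(2)[OF components(3) Rad_tangent[OF assms]])
  then have "g (tp v + lp v + pp v) \<xi> = g (lp v) \<xi>" by (simp add: form_simps)
  then show ?thesis by (simp only: components(4))
qed

lemma form_P:
  assumes "w \<in> P"
  shows "g v w = g (pp v) w"
proof -
  have "g (tp v) w = 0" "g (lp v) w = 0"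
    by (rule P_normal(1)[OF assms components(1)], rule LP[OF components(2) assms])
  then have "g (tp v + lp v + pp v) w = g (pp v) w" by (simp add: form_simps)
  then show ?thesis by (simp only: components(4))
qed

text \<open>\<open>component\<close> is a definite description, so additivity has to come from
  uniqueness of the splitting.\<close>

lemma lp_add: "lp (u + v) = lp u + lp v"
proof -
  have "(tp u + tp v) + (lp u + lp v) + (pp u + pp v) =
      (tp u + lp u + pp u) + (tp v + lp v + pp v)"
    by (simp only: ac_simps)
  also have "\<dots> = u + v" by (simp only: components(4))
  finally show ?thesis
    using components_eq(2)[of "tp u + tp v" "lp u + lp v" "pp u + pp v"] components sub
    by (simp add: subspace_add)
qed

text \<open>By symmetry of \<open>J\<close>, pairing \<open>J w\<close> with a radical vector is
  pairing \<open>w\<close> with another radical vector, which is tangent and so orthogonal to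
  \<open>w\<close>.\<close>

lemma lp_bronze_P: "w \<in> P \<Longrightarrow> lp (J w) = 0"
proof (rule pairing)
  fix \<xi>
  assume "w \<in> P" "\<xi> \<in> R"
  moreover have "J \<xi> \<in> R" using J_Rad \<open>\<xi> \<in> R\<close> by blast
  ultimately show "g (lp (J w)) \<xi> = 0"
    using form_Rad[of \<xi> "J w"] P_normal(2)[of w "J \<xi>"] Rad_tangent by (simp add: J_symmetric)
qed (rule components)

text \<open>In the application \<open>V\<close> is the derivative of \<open>Z\<close> along
  \<open>X\<close>, \<open>U\<close> that of its bronze image, and the scalars
  \<open>\<alpha>\<close>, \<open>\<beta>\<close> are the values of the form \<open>\<theta>\<close>
  on \<open>Z\<close> and on that image. \<open>UV\<close> is then the identity of
  \<open>along_connection_bronze\<close>.\<close>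

context
  fixes U V K :: 'e and \<alpha> \<beta> :: real
  assumes UV: "U + \<alpha> *\<^sub>R J K = J V + \<beta> *\<^sub>R K" and K: "K \<in> T" "J K \<in> T"
begin

lemma U_eq: "U = J V + \<beta> *\<^sub>R K - \<alpha> *\<^sub>R J K"
  using UV by (simp add: algebra_simps)

lemma lp_form_Rad: "\<xi> \<in> R \<Longrightarrow> g (lp U) \<xi> = g (lp V) (J \<xi>)"
proof -
  assume \<xi>: "\<xi> \<in> R"
  have "g (lp U) \<xi> = g U \<xi>" by (rule form_Rad[OF \<xi>, symmetric])
  also have "\<dots> = g V (J \<xi>)"
    unfolding U_eq using Rad_normal[OF \<xi> K(1)] Rad_normal[OF \<xi> K(2)]
    by (simp add: form_simps J_symmetric)
  also have "\<dots> = g (lp V) (J \<xi>)" using J_Rad \<xi> by (intro form_Rad) blast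
  finally show ?thesis .
qed

text \<open>By \<open>lp_form_Rad\<close> the part of \<open>U\<close> in \<open>L\<close> is tested
  against \<open>\<xi>\<close> as that of \<open>V\<close> is against \<open>J \<xi>\<close>, and
  \<open>J \<xi>\<close> runs through all of \<open>R\<close>.\<close>

lemma lp_zero_iff: "lp V = 0 \<longleftrightarrow> (\<forall>\<xi>\<in>R. g (lp U) \<xi> = 0)"
proof
  assume "\<forall>\<xi>\<in>R. g (lp U) \<xi> = 0"
  then have "g (lp V) \<zeta> = 0" if "\<zeta> \<in> R" for \<zeta>
    using that J_Rad lp_form_Rad by (metis imageE)
  then show "lp V = 0" by (intro pairing components)
qed (simp add: lp_form_Rad form_simps)

text \<open>The bronze equation says that 3 - \<open>J\<close> inverts \<open>J\<close> up to sign.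
  Applied to \<open>U\<close> it leaves \<open>- V\<close> and multiples of \<open>K\<close> and
  \<open>J K\<close>, which are tangent and so orthogonal to \<open>w\<close>.\<close>

lemma form_P_bronze:
  assumes w: "w \<in> P"
  shows "3 * g U w - g U (J w) = - g (pp V) w"
proof -
  have "3 *\<^sub>R U - J U = - V + ((3 * \<beta> + \<alpha>) *\<^sub>R K - \<beta> *\<^sub>R J K)"
    unfolding U_eq
    by (simp add: linear_add[OF J_linear] linear_diff[OF J_linear] linear_cmul[OF J_linear] J_bronze
        algebra_simps)
  from arg_cong[OF this, of "\<lambda>u. g u w"]
  have "3 * g U w - g (J U) w = - g V w"
    using P_normal(1)[OF w K(1)] P_normal(1)[OF w K(2)] by (simp add: form_simps)
  then show ?thesis by (simp add: J_symmetric form_P[OF w, of V])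
qed

text \<open>The algebraic form of condition (ii), with \<open>U1\<close> and \<open>U2\<close> the
  derivatives of the tangential and transversal parts. Expanded in components it reads 3 g(U, w) =
  g(U, J w), and \<open>form_P_bronze\<close> applies.\<close>

lemma pp_condition_iff:
  assumes w: "w \<in> P" and U: "U = U1 + U2" and 0: "lp U = 0"
  shows "3 * g (pp U1 + pp U2) w + g (- tp U2) (tp (J w)) =
      g (tp U1 + pp U1) (J w) + g (pp U2) (lp (J w) + pp (J w)) \<longleftrightarrow> g (pp V) w = 0"
proof -
  let ?t = "tp (J w)" and ?s = "pp (J w)"
  have Jw: "J w = ?t + ?s" using components(4)[of "J w"] lp_bronze_P[OF w] by simp
  have 1: "g (pp U1 + pp U2) w = g U w"
    by (simp add: U form_simps form_P[OF w, of U1] form_P[OF w, of U2])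
  have "U = (tp U1 + lp U1 + pp U1) + (tp U2 + lp U2 + pp U2)"
    unfolding U by (simp only: components(4))
  also have "\<dots> = (tp U1 + tp U2) + (lp U1 + lp U2) + (pp U1 + pp U2)" by (simp only: ac_simps)
  \<comment> \<open>The lightlike parts of \<open>U1\<close> and \<open>U2\<close> need not vanish
    separately; only their sum does, so the two terms are regrouped before \<open>g\<close> is
    expanded.\<close>
  finally have "U = (tp U1 + tp U2) + (pp U1 + pp U2)" using 0 lp_add[of U1 U2] U by simp
  then have "g U (J w) = g ((tp U1 + tp U2) + (pp U1 + pp U2)) (?t + ?s)" using Jw by metis
  also have "\<dots> = g (tp U1) ?t + g (tp U2) ?t + g (pp U1) ?s + g (pp U2) ?s"
    by (simp add: form_simps P_normal components)
  finally have 2: "g U (J w) = \<dots>" .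
  have "g (tp U1 + pp U1) (J w) = g (tp U1 + pp U1) (?t + ?s)" using Jw by metis
  also have "\<dots> = g (tp U1) ?t + g (pp U1) ?s"
    by (simp add: form_simps P_normal components)
  finally have 3: "g (tp U1 + pp U1) (J w) = \<dots>" .
  show ?thesis
    unfolding 1 3 lp_bronze_P[OF w] using form_P_bronze[OF w] 2 by (auto simp: form_simps)
qed

end

end

text \<open>Transfers the geometric data at \<open>x\<close> to the locale. The clause to be worked
  for is \<open>pairing\<close>, obtained from the dual local frames of the radical and of
  \<open>ltr M\<close>.\<close>

lemma bronze_splitting_at:
  fixes N :: "('p::{t2_space, second_countable_topology}, 'e::euclidean_space) bronze_data"
    and M :: "('m::{t2_space, second_countable_topology}, 'f::euclidean_space, 'p, 'e) lightlike_data"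
  assumes bm: "bronze_manifold N q" and sg: "screen_generic N M r"
  shows "bronze_splitting (metric_on N M x) (tangent N M x) (Rad N M x) (screen_transversal M x)
    (ltr M x) (bronze_on N M x)"
proof -
  let ?g = "metric_on N M x" and ?T = "tangent N M x" and ?R = "Rad N M x"
  let ?P = "screen_transversal M x" and ?L = "ltr M x"
  have lsub: "lightlike_submanifold N M r" using sg by (simp add: screen_generic_def)
  have bil: "bilinear ?g" and sym: "?g u v = ?g v u" and nd: "nondegenerate_on UNIV ?g" for u v
    using bm by (simp_all add: bronze_manifold_def semi_riemannian_metric_def metric_on_def)
  have lin: "linear (?g u)" "linear (\<lambda>u. ?g u v)" for u v using bil by (auto simp: bilinear_def)
  have sR: "subspace ?R" "dim ?R = r" and sS: "subspace (screen M x)" and sP: "subspace ?P"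
    using lsub by (auto simp: lightlike_submanifold_def smooth_bundle_def)
  have "?T = {u + v | u v. u \<in> ?R \<and> v \<in> screen M x}"
    using lsub by (simp add: lightlike_submanifold_def orthogonal_sum_def)
  then have sT: "subspace ?T" using subspace_sums[OF sR(1) sS] by simp
  have lt: "lightlike_transversal N M r" using lsub by (simp add: lightlike_submanifold_def)
  then have sL: "subspace ?L" "dim ?L = r"
    by (auto simp: lightlike_transversal_def smooth_bundle_def)
  from spec[OF conjunct2[OF lt[unfolded lightlike_transversal_def]], of x]
  obtain W \<xi>' n' where W: "x \<in> W"
    and all: "\<forall>y\<in>W. Rad N M y = span ((\<lambda>j. \<xi>' j y) ` {..<r}) \<and>
           ltr M y = span ((\<lambda>j. n' j y) ` {..<r}) \<and>
           (\<forall>i<r. \<forall>j<r. metric_on N M y (n' i y) (\<xi>' j y) = (if i = j then 1 else 0) \<and>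
              metric_on N M y (n' i y) (n' j y) = 0) \<and>
           (\<forall>i<r. \<forall>u \<in> screen M y \<union> screen_transversal M y. metric_on N M y (n' i y) u = 0)"
    by (elim exE conjE) (rule that)
  define \<xi> n where "\<xi> j = \<xi>' j x" and "n j = n' j x" for j
  have R: "?R = span (\<xi> ` {..<r})" and L: "?L = span (n ` {..<r})"
    and dual: "\<And>i j. i < r \<Longrightarrow> j < r \<Longrightarrow> ?g (n i) (\<xi> j) = (if i = j then 1 else 0)"
    and nP: "\<And>i u. i < r \<Longrightarrow> u \<in> ?P \<Longrightarrow> ?g (n i) u = 0"
    using bspec[OF all W] unfolding \<xi>_def n_def by auto
  \<comment> \<open>The coefficients of \<open>b\<close> in the frame \<open>n\<close> are its
    products with the dual frame \<open>\<xi>\<close>. The formula is linear in \<open>b\<close> and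
    holds on the frame, hence on its span.\<close>
  have expand: "?L \<subseteq> {b. b = (\<Sum>i<r. ?g b (\<xi> i) *\<^sub>R n i)}"
    unfolding L
  proof (rule span_minimal)
    show "n ` {..<r} \<subseteq> {b. b = (\<Sum>i<r. ?g b (\<xi> i) *\<^sub>R n i)}"
      by (auto simp: dual if_distrib[of "\<lambda>a. a *\<^sub>R _"] cong: if_cong)
    show "subspace {b. b = (\<Sum>i<r. ?g b (\<xi> i) *\<^sub>R n i)}"
      by (rule subspaceI)
        (simp_all add: linear_0[OF lin(2)] linear_add[OF lin(2)] linear_cmul[OF lin(2)]
          scaleR_add_left sum.distrib flip: scaleR_scaleR scaleR_sum_right)
  qed
  have LP: "?L \<subseteq> {b. ?g b c = 0}" if "c \<in> ?P" for c
    unfolding L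
    by (rule span_minimal)
      (use nP that in \<open>auto intro!: subspaceI simp: linear_0[OF lin(2)] linear_add[OF lin(2)]
        linear_cmul[OF lin(2)]\<close>)
  show ?thesis
  proof (intro bronze_splitting.intro lightlike_splitting.intro bronze_splitting_axioms.intro)
    show "bilinear ?g" "nondegenerate_on UNIV ?g" by fact+
    show "?g u v = ?g v u" for u v by fact
    show "subspace ?T" "subspace ?R" "subspace ?P" "subspace ?L" by fact+
    show "dim ?L = dim ?R" using sR sL by simp
    show "?R = ?T \<inter> {v. \<forall>u\<in>?T. ?g u v = 0}" by (simp add: Rad_def normal_def)
    show "orthogonal_sum ?g {v. \<forall>u\<in>?T. ?g u v = 0} ?R ?P"
      using lsub by (simp add: lightlike_submanifold_def normal_def)
    show "b = 0" if b: "b \<in> ?L" and 0: "\<And>\<xi>. \<xi> \<in> ?R \<Longrightarrow> ?g b \<xi> = 0" for b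
    proof -
      have "?g b (\<xi> i) = 0" if "i < r" for i
        using that by (intro 0) (auto simp: R intro: span_base)
      then have "(\<Sum>i<r. ?g b (\<xi> i) *\<^sub>R n i) = 0" by simp
      then show ?thesis using expand b by auto
    qed
    show "?g b c = 0" if "b \<in> ?L" "c \<in> ?P" for b c using LP that by blast
    show "linear (bronze_on N M x)" using bm by (simp add: bronze_manifold_def bronze_on_def)
    show "bronze_on N M x (bronze_on N M x v) = 3 *\<^sub>R bronze_on N M x v + v" for v
      using bm by (simp add: bronze_manifold_def bronze_on_def)
    show "?g (bronze_on N M x u) v = ?g u (bronze_on N M x v)" for u v
      using bm by (simp add: bronze_manifold_def bronze_on_def metric_on_def)
    show "bronze_on N M x ` ?R = ?R" using sg by (simp add: screen_generic_def)
  qed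
qed

text \<open>If \<open>u\<close> is the bronze image of \<open>s\<close> and both lie in the screen,
  the bronze equation sends \<open>u\<close> to \<open>3 *\<^sub>R u + s\<close>, again in the
  screen. The radical part is invariant by hypothesis.\<close>

lemma B_inv_tangent:
  fixes N :: "('p::{t2_space, second_countable_topology}, 'e::euclidean_space) bronze_data"
    and M :: "('m::{t2_space, second_countable_topology}, 'f::euclidean_space, 'p, 'e) lightlike_data"
  assumes bm: "bronze_manifold N q" and sg: "screen_generic N M r" and v: "v \<in> B_inv N M x"
  shows "v \<in> tangent N M x" "bronze_on N M x v \<in> tangent N M x"
proof -
  interpret bronze_splitting "metric_on N M x" "tangent N M x" "Rad N M x" "screen_transversal M x"
    "ltr M x" "bronze_on N M x"
    by (rule bronze_splitting_at[OF bm sg])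
  have lsub: "lightlike_submanifold N M r" using sg by (simp add: screen_generic_def)
  have S: "subspace (screen M x)"
    using lsub by (auto simp: lightlike_submanifold_def smooth_bundle_def)
  have "tangent N M x = {u + v | u v. u \<in> Rad N M x \<and> v \<in> screen M x}"
    using lsub by (simp add: lightlike_submanifold_def orthogonal_sum_def)
  moreover have "0 + u = u" "0 \<in> Rad N M x" for u :: 'e using sub subspace_0 by auto
  ultimately have ST: "u \<in> tangent N M x" if "u \<in> screen M x" for u using that by fastforce
  obtain u \<xi> where u: "u \<in> B_o N M x" and \<xi>: "\<xi> \<in> Rad N M x" and v': "v = u + \<xi>"
    using v by (auto simp: B_inv_def)
  obtain s where s: "s \<in> screen M x" "u = bronze_on N M x s" and uS: "u \<in> screen M x"
    using u by (auto simp: B_o_def)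
  have "bronze_on N M x u = 3 *\<^sub>R u + s" using s(2) J_bronze by simp
  then have Ju: "bronze_on N M x u \<in> screen M x"
    using S s(1) uS by (simp add: subspace_add subspace_scale)
  have J\<xi>: "bronze_on N M x \<xi> \<in> Rad N M x" using J_Rad \<xi> by blast
  show "v \<in> tangent N M x"
    unfolding v' by (intro subspace_add[OF sub(1)] ST uS Rad_tangent \<xi>)
  show "bronze_on N M x v \<in> tangent N M x"
    unfolding v' linear_add[OF J_linear] by (intro subspace_add[OF sub(1)] ST Ju Rad_tangent J\<xi>)
qed

theorem theorem5p17:
  fixes N :: "('p::{t2_space, second_countable_topology}, 'e::euclidean_space) bronze_data"
    and M :: "('m::{t2_space, second_countable_topology}, 'f::euclidean_space, 'p, 'e) lightlike_data"
    and nab :: "('p \<Rightarrow> 'e) \<Rightarrow> ('p \<Rightarrow> 'e) \<Rightarrow> 'p \<Rightarrow> 'e"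
    and l m :: "'p \<Rightarrow> real" and \<eta> :: "'p \<Rightarrow> 'e"
    and \<Omega> :: "('m \<Rightarrow> 'e) \<Rightarrow> ('m \<Rightarrow> 'e) \<Rightarrow> 'm \<Rightarrow> 'e"
    and q r :: nat
  assumes ambient: "locally_bronze N q nab"
    and lm: "lm_connection_data N l m \<eta>"
    and sub: "screen_generic N M r"
    and conn: "along_connection N M (lm_connection N nab l m \<eta>) \<Omega>"
  shows "mixed_geodesic N M \<Omega> \<longleftrightarrow>
    (\<forall>X \<in> sections N M (B_inv N M). \<forall>Z \<in> sections N M (B_prime N M).
     \<forall>\<xi> \<in> sections N M (Rad N M). \<forall>W \<in> sections N M (screen_transversal M). \<forall>x.
       (let g = metric_on N M x; J = bronze_on N M x; \<theta> = \<theta>_form N \<eta> (imm M x);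
            lx = l (imm M x); mx = m (imm M x); fZ = f_part N M Z; wZ = w_part N M Z
        in
          g (h_l N M \<Omega> X fZ x) (\<xi> x) + lx * \<theta> (Z x) * g (J (X x)) (\<xi> x)
            + 3 * mx * \<theta> (Z x) * g (J (X x)) (\<xi> x) + mx * \<theta> (Z x) * g (X x) (\<xi> x)
          = - g (D_l N M \<Omega> X wZ x) (\<xi> x) + lx * \<theta> (J (Z x)) * g (X x) (\<xi> x)
            + mx * \<theta> (J (Z x)) * g (J (X x)) (\<xi> x)
        \<and>
          3 * g (h_s N M \<Omega> X fZ x + conn_s N M \<Omega> X wZ x) (W x)
            + g (shape N M \<Omega> wZ X x) (f_part N M W x)
          = g (ind_conn N M \<Omega> X fZ x + h_s N M \<Omega> X fZ x) (J (W x))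
            + g (conn_s N M \<Omega> X wZ x) (w_part N M W x)))"
proof -
  let ?\<theta> = "\<lambda>x. \<theta>_form N \<eta> (imm M x)" and ?J = "bronze_on N M" and ?g = "metric_on N M"
  let ?lp = "\<lambda>x. component (ltr M x) (tangent N M x) (screen_transversal M x)"
  let ?pp = "\<lambda>x. component (screen_transversal M x) (tangent N M x) (ltr M x)"
  let ?tp = "\<lambda>x. component (tangent N M x) (ltr M x) (screen_transversal M x)"
  have bm: "bronze_manifold N q" using ambient by (simp add: locally_bronze_def)
  have lsub: "lightlike_submanifold N M r" using sub by (simp add: screen_generic_def)
  have sm: "smooth_mapping (sub_atlas M) (atlas N) (imm M)"
    using bm lsub by (simp add: smooth_mapping_def bronze_manifold_def lightlike_submanifold_def)
  interpret smooth_mapping "sub_atlas M" "atlas N" "imm M" by (rule sm)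
  interpret split: bronze_splitting "?g x" "tangent N M x" "Rad N M x" "screen_transversal M x"
    "ltr M x" "?J x" for x
    by (rule bronze_splitting_at[OF bm sub])
  obtain k where Pbundle: "smooth_bundle N M (screen_transversal M) k"
    using lsub by (auto simp: lightlike_submanifold_def)
  have Rbundle: "smooth_bundle N M (Rad N M) r" using lsub by (simp add: lightlike_submanifold_def)
  let ?cond = "\<lambda>X Z \<xi> W x.
     (let g = metric_on N M x; J = bronze_on N M x; \<theta> = \<theta>_form N \<eta> (imm M x);
          lx = l (imm M x); mx = m (imm M x); fZ = f_part N M Z; wZ = w_part N M Z
      in
        g (h_l N M \<Omega> X fZ x) (\<xi> x) + lx * \<theta> (Z x) * g (J (X x)) (\<xi> x)
          + 3 * mx * \<theta> (Z x) * g (J (X x)) (\<xi> x) + mx * \<theta> (Z x) * g (X x) (\<xi> x)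
        = - g (D_l N M \<Omega> X wZ x) (\<xi> x) + lx * \<theta> (J (Z x)) * g (X x) (\<xi> x)
          + mx * \<theta> (J (Z x)) * g (J (X x)) (\<xi> x)
      \<and>
        3 * g (h_s N M \<Omega> X fZ x + conn_s N M \<Omega> X wZ x) (W x)
          + g (shape N M \<Omega> wZ X x) (f_part N M W x)
        = g (ind_conn N M \<Omega> X fZ x + h_s N M \<Omega> X fZ x) (J (W x))
          + g (conn_s N M \<Omega> X wZ x) (w_part N M W x))"
  \<comment> \<open>The equivalence already holds for each fixed pair \<open>X\<close>,
    \<open>Z\<close>, since both sides of the theorem quantify over the same pairs.\<close>
  have main: "(\<forall>x. h_l N M \<Omega> X Z x = 0 \<and> h_s N M \<Omega> X Z x = 0) \<longleftrightarrow>
      (\<forall>\<xi> \<in> sections N M (Rad N M). \<forall>W \<in> sections N M (screen_transversal M). \<forall>x. ?cond X Z \<xi> W x)"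
    if X: "X \<in> sections N M (B_inv N M)" and Z: "Z \<in> sections N M (B_prime N M)" for X Z
  proof -
    have XT: "X x \<in> tangent N M x" "?J x (X x) \<in> tangent N M x" for x
      using X B_inv_tangent[OF bm sub, of "X x"] by (auto simp: sections_def)
    have X': "X \<in> sections N M (tangent N M)" using X XT by (simp add: sections_def)
    define K where "K x = l (imm M x) *\<^sub>R X x + m (imm M x) *\<^sub>R ?J x (X x)" for x
    \<comment> \<open>The bronze equation rewrites the second image of \<open>X x\<close> as a
      combination of \<open>X x\<close> and its first image, both tangent.\<close>
    have KT: "K x \<in> tangent N M x" "?J x (K x) \<in> tangent N M x" for x
      using XT[of x] split.sub(1)[of x]
      by (simp_all add: K_def subspace_add subspace_scale linear_add[OF split.J_linear]
          linear_cmul[OF split.J_linear] split.J_bronze)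
    let ?fZ = "f_part N M Z" and ?wZ = "w_part N M Z"
    have fw: "?fZ \<in> sections N M (B_prime N M)" "?wZ \<in> sections N M (screen_transversal M)"
      using sub Z by (simp_all add: screen_generic_def)
    have JZ: "(\<lambda>y. ?J y (Z y)) = (\<lambda>y. ?fZ y + ?wZ y)"
      using split.components(4)
      by (simp add: f_part_def w_part_def tan_part_def ltr_part_def str_part_def add.assoc)
    have TN: "Z \<in> sections N M (\<lambda>_. UNIV)" "?fZ \<in> sections N M (\<lambda>_. UNIV)"
        "?wZ \<in> sections N M (\<lambda>_. UNIV)"
      using Z fw by (auto simp: sections_def)
    have JZTN: "(\<lambda>y. ?J y (Z y)) \<in> sections N M (\<lambda>_. UNIV)"
      unfolding JZ using TN(2,3) by (simp add: sections_def smooth_over_def smooth_along_add)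
    have sum: "\<Omega> X (\<lambda>y. ?J y (Z y)) x = \<Omega> X ?fZ x + \<Omega> X ?wZ x" for x
      unfolding JZ using conn X' TN(2,3) by (simp add: along_connection_def Let_def)
    have UV: "\<Omega> X (\<lambda>y. ?J y (Z y)) x + ?\<theta> x (Z x) *\<^sub>R ?J x (K x) =
        ?J x (\<Omega> X Z x) + ?\<theta> x (?J x (Z x)) *\<^sub>R K x" for x
      unfolding K_def by (rule along_connection_bronze[OF ambient conn sm X' TN(1) JZTN])
    define U where "U = \<Omega> X (\<lambda>y. ?J y (Z y))"
    have lpU: "?lp x (\<Omega> X ?fZ x) + ?lp x (\<Omega> X ?wZ x) = ?lp x (U x)" for x
      unfolding U_def sum by (rule split.lp_add[symmetric])
    have lp_iff: "?lp x (\<Omega> X Z x) = 0 \<longleftrightarrow> (\<forall>\<xi>\<in>Rad N M x. ?g x (?lp x (U x)) \<xi> = 0)" for x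
      unfolding U_def by (rule split.lp_zero_iff[OF UV KT])
    have pp_iff: "?g x (?pp x (\<Omega> X Z x)) w = 0 \<longleftrightarrow>
        3 * ?g x (?pp x (\<Omega> X ?fZ x) + ?pp x (\<Omega> X ?wZ x)) w + ?g x (- ?tp x (\<Omega> X ?wZ x)) (?tp x (?J x w)) =
        ?g x (?tp x (\<Omega> X ?fZ x) + ?pp x (\<Omega> X ?fZ x)) (?J x w) +
        ?g x (?pp x (\<Omega> X ?wZ x)) (?lp x (?J x w) + ?pp x (?J x w))"
      if "?lp x (U x) = 0" "w \<in> screen_transversal M x" for x w
      using split.pp_condition_iff[OF UV KT that(2) sum] that(1) unfolding U_def by simp
    \<comment> \<open>All terms of (i) carrying \<open>\<theta>\<close> vanish, as \<open>X\<close>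
      and its bronze image are tangent and \<open>\<xi>\<close> is radical. The two lightlike parts
      that remain add up to that of \<open>U\<close> by \<open>lpU\<close>.\<close>
    have cond: "?cond X Z \<xi> W x \<longleftrightarrow> ?g x (?lp x (U x)) (\<xi> x) = 0 \<and>
        3 * ?g x (?pp x (\<Omega> X ?fZ x) + ?pp x (\<Omega> X ?wZ x)) (W x)
          + ?g x (- ?tp x (\<Omega> X ?wZ x)) (?tp x (?J x (W x))) =
        ?g x (?tp x (\<Omega> X ?fZ x) + ?pp x (\<Omega> X ?fZ x)) (?J x (W x)) +
        ?g x (?pp x (\<Omega> X ?wZ x)) (?lp x (?J x (W x)) + ?pp x (?J x (W x)))"
      if "\<xi> \<in> sections N M (Rad N M)" for \<xi> W x
    proof -
      have "\<xi> x \<in> Rad N M x" using that by (simp add: sections_def)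
      note 0 = split.Rad_normal[OF this XT(1)] split.Rad_normal[OF this XT(2)]
      show ?thesis
        unfolding Let_def h_l_def h_s_def D_l_def conn_s_def shape_def ind_conn_def
          f_part_def[of N M W] w_part_def[of N M W] tan_part_def ltr_part_def str_part_def
        by (simp add: 0 eq_neg_iff_add_eq_0 split.form_simps flip: lpU)
    qed
    show ?thesis
    proof (intro iffI allI ballI)
      fix \<xi> W x
      assume 0: "\<forall>x. h_l N M \<Omega> X Z x = 0 \<and> h_s N M \<Omega> X Z x = 0"
        and \<xi>: "\<xi> \<in> sections N M (Rad N M)" and W: "W \<in> sections N M (screen_transversal M)"
      have V: "?lp x (\<Omega> X Z x) = 0" "?pp x (\<Omega> X Z x) = 0"
        using 0 by (simp_all add: h_l_def h_s_def ltr_part_def str_part_def)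
      have lp0: "?lp x (U x) = 0"
        using V(1) by (intro split.pairing[where x = x] split.components) (auto simp: lp_iff)
      have "W x \<in> screen_transversal M x" using W by (simp add: sections_def)
      then show "?cond X Z \<xi> W x"
        unfolding cond[OF \<xi>]
        by (intro conjI iffD1[OF pp_iff[OF lp0]]) (simp_all add: lp0 V(2) split.form_simps)
    next
      fix x
      assume c: "\<forall>\<xi> \<in> sections N M (Rad N M). \<forall>W \<in> sections N M (screen_transversal M). \<forall>x.
        ?cond X Z \<xi> W x"
      \<comment> \<open>Condition (ii) yields information on the screen transversal part only after
        (i) has been used for every radical vector to show \<open>?lp x (U x) = 0\<close>; hence the
        implication.\<close>
      have zero: "?g x (?lp x (U x)) \<zeta> = 0 \<and>
          (?lp x (U x) = 0 \<longrightarrow> ?g x (?pp x (\<Omega> X Z x)) w = 0)"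
        if \<zeta>: "\<zeta> \<in> Rad N M x" and w: "w \<in> screen_transversal M x" for \<zeta> w
      proof -
        obtain \<xi> where \<xi>: "\<xi> \<in> sections N M (Rad N M)" "\<xi> x = \<zeta>"
          using section_through[OF sm Rbundle \<zeta>] .
        obtain W where W: "W \<in> sections N M (screen_transversal M)" "W x = w"
          using section_through[OF sm Pbundle w] .
        have "?cond X Z \<xi> W x" using c \<xi>(1) W(1) by blast
        from iffD1[OF cond[OF \<xi>(1)] this] show ?thesis
          unfolding \<xi>(2) W(2) using pp_iff[OF _ w] by blast
      qed
      \<comment> \<open>Both conditions come under joint quantifiers over \<open>\<xi>\<close> and
        \<open>W\<close>, so each is extracted with the zero vector in the other slot:
        \<open>w = 0\<close> here, \<open>\<zeta> = 0\<close> below.\<close>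
      have lp0: "?lp x (U x) = 0"
        using zero[of _ 0] split.sub(3)[of x] by (intro split.pairing[where x = x] split.components) (simp add: subspace_0)
      have "?lp x (\<Omega> X Z x) = 0" by (simp add: lp_iff lp0 split.form_simps)
      moreover have "?pp x (\<Omega> X Z x) = 0"
        using zero[of 0] lp0 split.sub(2)[of x]
        by (intro split.nondegenerate_P[where x = x] split.components) (simp add: subspace_0)
      ultimately show "h_l N M \<Omega> X Z x = 0 \<and> h_s N M \<Omega> X Z x = 0"
        by (simp add: h_l_def h_s_def ltr_part_def str_part_def)
    qed
  qed
  show ?thesis
    unfolding mixed_geodesic_def by (intro ball_cong refl main)
qed

end
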